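(* For every even integer $r \geq 6$, $$f_r(n) \leq \left(\frac{14}{15}\right)^{\frac{r}{6}} (1+o(1)) \binom{n}{\lfloor r/2 \rfloor},$$ where the $o(1)$ term is as $n \to \infty$ with $r$ fixed.
   Context: An $r$-graph is an $r$-uniform hypergraph. A complete $r$-partite $r$-graph (also called a block) on a ground set $V$ is given by pairwise disjoint nonempty subsets $V_1,\dots,V_r$ of $V$ (not required to have union $V$); its edges are all $r$-element sets containing precisely one vertex from each $V_i$. For positive integers $r, n$, $f_r(n)$ denotes the minimum number of complete $r$-partite $r$-graphs (on subsets of the $n$-element vertex set) needed to partition the edge set of the complete $r$-uniform hypergraph on $n$ vertices, i.e. so that every $r$-element subset of the vertex set is an edge of exactly one of them. *)

theory Defs
  imports Complex_Main "HOL-Library.Disjoint_Sets" "HOL-Library.Ramsey" "HOL-Library.Landau_Symbols"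
begin

text \<open>
  An r-graph is identified with its set of edges, and \<open>nsets V r\<close> is the set of all
  r-element subsets of \<open>V\<close>, i.e. the edge set of the complete r-uniform hypergraph on \<open>V\<close>.
\<close>

definition multipartite_edges :: "nat \<Rightarrow> 'a set \<Rightarrow> (nat \<Rightarrow> 'a set) \<Rightarrow> 'a set set" where
  "multipartite_edges r V P = {e \<in> nsets V r. \<forall>i<r. card (e \<inter> P i) = 1}"

definition is_block :: "nat \<Rightarrow> 'a set \<Rightarrow> 'a set set \<Rightarrow> bool" where
  "is_block r V E \<longleftrightarrow>
     (\<exists>P. (\<forall>i<r. P i \<subseteq> V \<and> P i \<noteq> {}) \<and> disjoint_family_on P {..<r} \<and>
          E = multipartite_edges r V P)"

text \<open>
  A block has at least one edge, so distinct members of a partition have distinct edge sets;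
  hence counting blocks by their edge sets loses no multiplicities, and the requirement in
  \<open>partition_on\<close> that all parts are nonempty excludes nothing.
\<close>

definition block_partition :: "nat \<Rightarrow> 'a set \<Rightarrow> 'a set set set \<Rightarrow> bool" where
  "block_partition r V \<B> \<longleftrightarrow>
     finite \<B> \<and> (\<forall>E\<in>\<B>. is_block r V E) \<and> partition_on (nsets V r) \<B>"

text \<open>The quantity written $f_r(n)$ in the literature.\<close>

definition block_number :: "nat \<Rightarrow> nat \<Rightarrow> nat" where
  "block_number r n = (LEAST m. \<exists>\<B>. block_partition r {..<n} \<B> \<and> card \<B> = m)"

text \<open>The minimum is attained, since every single edge is itself a block.\<close>

lemma is_block_singleton:
  assumes "e \<in> nsets V r"
  shows "is_block r V {e}"
proof -
  from assms have e: "e \<subseteq> V" "finite e" "card e = r" by (auto simp: nsets_def)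
  then obtain g where g: "bij_betw g {..<r} e"
    using ex_bij_betw_nat_finite by (metis atLeast0LessThan)
  have ge: "g i \<in> e" if "i < r" for i using g that by (auto simp: bij_betw_def)
  have "{e} = multipartite_edges r V (\<lambda>i. {g i})"
  proof (intro equalityI subsetI)
    fix x assume "x \<in> {e}"
    then show "x \<in> multipartite_edges r V (\<lambda>i. {g i})"
      using assms ge by (auto simp: multipartite_edges_def)
  next
    fix x assume x: "x \<in> multipartite_edges r V (\<lambda>i. {g i})"
    then have x': "finite x" "card x = r" and c: "\<And>i. i < r \<Longrightarrow> card (x \<inter> {g i}) = 1"
      by (auto simp: multipartite_edges_def nsets_def)
    have "g i \<in> x" if "i < r" for i using c[OF that] by (cases "g i \<in> x") auto
    then have "e \<subseteq> x" using g by (auto simp: bij_betw_def)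
    with x' e have "x = e" by (metis card_subset_eq)
    then show "x \<in> {e}" by simp
  qed
  moreover have "disjoint_family_on (\<lambda>i. {g i}) {..<r}"
    using g by (auto simp: disjoint_family_on_def bij_betw_def inj_on_def)
  ultimately show ?thesis
    unfolding is_block_def using ge e by (intro exI[of _ "\<lambda>i. {g i}"]) auto
qed

lemma block_number_attained: "\<exists>\<B>. block_partition r {..<n} \<B> \<and> card \<B> = block_number r n"
proof -
  let ?B = "(\<lambda>e. {e}) ` nsets {..<n} r"
  have "block_partition r {..<n} ?B"
    unfolding block_partition_def
    by (auto simp: is_block_singleton finite_imp_finite_nsets partition_on_def disjoint_def)
  then have "\<exists>m \<B>. block_partition r {..<n} \<B> \<and> card \<B> = m" by blast
  then show ?thesis unfolding block_number_def by (rule LeastI_ex)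
qed

end

theory Submission
  imports Defs
begin

text \<open>
  Write \<open>k = r div 2\<close>. The bound \<open>n ^ k / fact k\<close> comes from cutting the vertices into many intervals:
  most of the cost is caused by edges that have two vertices in each of \<open>k\<close> different intervals, and
  the complete graph on \<open>s\<close> vertices is a union of about \<open>s\<close> complete bipartite graphs. This treats
  the intervals independently. The improvement is to treat them two at a time. For disjoint sets \<open>U\<close>
  and \<open>W\<close> of size \<open>s\<close>, the pairs formed by an edge in \<open>U\<close> and an edge in \<open>W\<close> can be partitioned into
  about \<open>11 / 12 * s\<^sup>2\<close> products of two complete bipartite graphs, instead of the obvious \<open>s\<^sup>2\<close>
  (lemma \<open>decomposable_grids\<close>).

  The saving comes from the following fact about a graph split into classes of edges: a union of
  classes can be much cheaper to decompose than its members. Divide \<open>U\<close> into 3 and \<open>W\<close> into 4 groups,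
  and number the vertices of each group. Between two groups, the matching of vertices with equal
  numbers and its complement both need as many bipartite graphs as a group has vertices, while their
  union needs only one. One may therefore tile the product of the two edge sets by products of unions
  of classes, where the decomposition of the edges in \<open>U\<close> varies with the edge in \<open>W\<close>. Decomposing
  both sides separately costs \<open>3 * 4 = 12\<close> units, and a tiling into six rectangles costs 11.

  The rest is a recursion that adds four to the number of vertices of an edge
  (lemma \<open>dec_number_step\<close>). Split off the last two intervals that an edge meets. If each of them
  contains two vertices, the tiling gives a factor \<open>11 / 12\<close>; all other cases are of lower order in \<open>n\<close>
  or in the number of intervals, and \<open>14 / 15\<close> leaves room for them. Hence the block number is
  eventually at most \<open>(14 / 15) ^ (k div 2) * n ^ k / fact k\<close>, and \<open>k div 2\<close> is at least
  \<open>k / 3 = r / 6\<close> for \<open>k \<ge> 3\<close>.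
\<close>

section \<open>Decompositions into blocks\<close>

definition block_edges :: "'a set list \<Rightarrow> 'a set set" where
  "block_edges As = {set xs |xs. list_all2 (\<in>) xs As}"

text \<open>
  The number is an upper bound for the number of blocks, not the exact count, and parts are allowed
  to be empty, in which case the block has no edges. Both make the notion stable under passing to a
  subset of the vertices. Having unions as a constructor reduces every closure property below to the
  case of a single block.
\<close>

inductive decomposable :: "nat \<Rightarrow> 'a set set \<Rightarrow> nat \<Rightarrow> bool" where
  decomposable_empty: "decomposable r {} b"
| decomposable_block: "length As = r \<Longrightarrow> sorted_wrt disjnt As \<Longrightarrow> decomposable r (block_edges As) 1"
| decomposable_Un: "decomposable r F a \<Longrightarrow> decomposable r G b \<Longrightarrow> F \<inter> G = {} \<Longrightarrow>
    decomposable r (F \<union> G) (a + b)"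

lemma decomposable_mono: "decomposable r F a \<Longrightarrow> a \<le> b \<Longrightarrow> decomposable r F b"
  using decomposable_Un[of r F a "{}" "b - a"] by (simp add: decomposable_empty)

lemma decomposable_UN:
  assumes "finite I" and "\<And>i. i \<in> I \<Longrightarrow> decomposable r (F i) (b i)" and "disjoint_family_on F I"
  shows "decomposable r (\<Union>i\<in>I. F i) (\<Sum>i\<in>I. b i)"
  using assms
proof (induction I rule: finite_induct)
  case empty
  then show ?case by (simp add: decomposable_empty)
next
  case (insert x I)
  have "F x \<inter> (\<Union>i\<in>I. F i) = {}"
    using insert.prems(2) insert.hyps(2) by (fastforce simp: disjoint_family_on_def)
  moreover have "disjoint_family_on F I"
    using insert.prems(2) by (auto simp: disjoint_family_on_def)
  ultimately show ?case
    using decomposable_Un[OF insert.prems(1)[of x]] insert by auto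
qed

lemma Union_block_edges:
  assumes "block_edges As \<noteq> {}"
  shows "\<Union> (block_edges As) = \<Union> (set As)"
proof -
  from assms obtain xs where xs: "list_all2 (\<in>) xs As" by (auto simp: block_edges_def)
  have "\<exists>e\<in>block_edges As. x \<in> e" if "x \<in> As ! i" "i < length As" for x i
    using xs that
    by (intro bexI[of _ "set (xs[i := x])"])
       (auto simp: block_edges_def list_all2_conv_all_nth nth_list_update set_update_memI
             intro!: exI[of _ "xs[i := x]"])
  then have "\<Union> (set As) \<subseteq> \<Union> (block_edges As)"
    by (auto simp: in_set_conv_nth)
  moreover have "x \<in> \<Union> (set As)" if "list_all2 (\<in>) ys As" "x \<in> set ys" for x ys
    using that by (auto simp: list_all2_conv_all_nth in_set_conv_nth intro!: bexI[OF _ nth_mem])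
  then have "\<Union> (block_edges As) \<subseteq> \<Union> (set As)"
    by (auto simp: block_edges_def)
  ultimately show ?thesis by blast
qed

lemma block_edges_Nil: "block_edges [] = {{}}"
  by (simp add: block_edges_def)

lemma block_edges_append:
  "block_edges (As @ Bs) = {e \<union> f |e f. e \<in> block_edges As \<and> f \<in> block_edges Bs}"
proof (intro equalityI subsetI)
  fix e assume "e \<in> block_edges (As @ Bs)"
  then obtain xs ys where "list_all2 (\<in>) xs As" "list_all2 (\<in>) ys Bs" "e = set xs \<union> set ys"
    by (auto simp: block_edges_def list_all2_append2)
  then show "e \<in> {e \<union> f |e f. e \<in> block_edges As \<and> f \<in> block_edges Bs}"
    unfolding block_edges_def by blast
next
  fix e assume "e \<in> {e \<union> f |e f. e \<in> block_edges As \<and> f \<in> block_edges Bs}"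
  then obtain xs ys where "list_all2 (\<in>) xs As" "list_all2 (\<in>) ys Bs" "e = set (xs @ ys)"
    by (auto simp: block_edges_def)
  then show "e \<in> block_edges (As @ Bs)"
    unfolding block_edges_def using list_all2_appendI by blast
qed

lemma block_edges_single: "block_edges [A] = {{x} |x. x \<in> A}"
proof (intro equalityI subsetI)
  fix e assume "e \<in> {{x} |x. x \<in> A}"
  then obtain x where "e = set [x]" "list_all2 (\<in>) [x] [A]" by auto
  then show "e \<in> block_edges [A]" unfolding block_edges_def by blast
qed (auto simp: block_edges_def list_all2_Cons2)

lemma block_edges_pair: "block_edges [A, B] = {{x, y} |x y. x \<in> A \<and> y \<in> B}"
  using block_edges_append[of "[A]" "[B]"] by (auto simp: block_edges_single)

text \<open>
  For edge sets on disjoint vertex sets, \<open>join\<close> is the Cartesian product of the two edge sets,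
  realised inside one hypergraph. It turns products of blocks into blocks.
\<close>

definition join :: "'a set set \<Rightarrow> 'a set set \<Rightarrow> 'a set set" where
  "join F G = {e \<union> f |e f. e \<in> F \<and> f \<in> G}"

lemma join_Un_left: "join (F \<union> F') G = join F G \<union> join F' G"
  and join_Un_right: "join F (G \<union> G') = join F G \<union> join F G'"
  and join_UN_left: "join (\<Union>i\<in>I. H i) G = (\<Union>i\<in>I. join (H i) G)"
  and join_empty_left: "join {} G = {}"
  and join_empty_right: "join F {} = {}"
  and join_unit: "join F {{}} = F"
  by (auto simp: join_def)

lemma join_assoc: "join (join F G) H = join F (join G H)"
proof (intro equalityI subsetI)
  fix x assume "x \<in> join (join F G) H"
  then obtain e f h where "e \<in> F" "f \<in> G" "h \<in> H" "x = e \<union> (f \<union> h)"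
    by (auto simp: join_def Un_assoc)
  then show "x \<in> join F (join G H)" unfolding join_def by blast
next
  fix x assume "x \<in> join F (join G H)"
  then obtain e f h where "e \<in> F" "f \<in> G" "h \<in> H" "x = (e \<union> f) \<union> h"
    by (auto simp: join_def Un_assoc)
  then show "x \<in> join (join F G) H" unfolding join_def by blast
qed

lemma Union_join: "\<Union> (join F G) \<subseteq> \<Union> F \<union> \<Union> G"
  by (auto simp: join_def)

lemma join_disjoint:
  assumes "F \<inter> F' = {} \<or> G \<inter> G' = {}" "\<Union> F \<subseteq> U" "\<Union> F' \<subseteq> U" "\<Union> G \<subseteq> W" "\<Union> G' \<subseteq> W" "U \<inter> W = {}"
  shows "join F G \<inter> join F' G' = {}"
proof -
  have "e = e' \<and> f = f'" if "e \<in> F" "e' \<in> F'" "f \<in> G" "f' \<in> G'" "e \<union> f = e' \<union> f'" for e e' f f'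
  proof -
    have "e \<subseteq> U" "e' \<subseteq> U" "f \<subseteq> W" "f' \<subseteq> W" using that assms by auto
    then show ?thesis using that(5) assms(6) by blast
  qed
  then show ?thesis
    using assms(1) by (auto simp: join_def) blast+
qed

text \<open>
  Concatenating the part lists of an \<open>r\<close>-partite block and an \<open>s\<close>-partite block on disjoint vertex
  sets gives an \<open>(r + s)\<close>-partite block, and products distribute over disjoint unions. Nonempty
  blocks are what guarantees disjointness of the parts: the parts of an edgeless block may reach
  outside the vertex set.
\<close>

lemma decomposable_join:
  assumes "decomposable r F a" "decomposable s G b" "\<Union> F \<inter> \<Union> G = {}"
  shows "decomposable (r + s) (join F G) (a * b)"
  using assms
proof (induction r F a rule: decomposable.induct)
  case (decomposable_empty r c)
  then show ?case by (simp add: join_empty_left decomposable.decomposable_empty)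
next
  case (decomposable_block As r)
  note As = decomposable_block(1,2)
  from decomposable_block(3,4) show ?case
  proof (induction s G b rule: decomposable.induct)
    case (decomposable_empty r c)
    then show ?case by (simp add: join_empty_right decomposable.decomposable_empty)
  next
    case (decomposable_block Bs s)
    show ?case
    proof (cases "block_edges As = {} \<or> block_edges Bs = {}")
      case True
      then show ?thesis
        by (auto simp: join_empty_right join_empty_left decomposable.decomposable_empty)
    next
      case False
      then have "\<Union> (set As) \<inter> \<Union> (set Bs) = {}"
        using decomposable_block(3) by (simp add: Union_block_edges)
      then have "sorted_wrt disjnt (As @ Bs)"
        using As decomposable_block(2) by (simp add: sorted_wrt_append disjnt_def) blast
      then show ?thesis
        using decomposable.decomposable_block[of "As @ Bs" "r + s"] As decomposable_block
        by (simp add: join_def block_edges_append)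
    qed
  next
    case (decomposable_Un s G b G' b')
    have "join (block_edges As) G \<inter> join (block_edges As) G' = {}"
      by (rule join_disjoint[of _ _ _ _ "\<Union> (block_edges As)" "\<Union> (G \<union> G')"])
         (use decomposable_Un in auto)
    moreover have "decomposable (r + s) (join (block_edges As) G) (1 * b)"
      by (rule decomposable_Un.IH(1)) (use decomposable_Un.prems in auto)
    moreover have "decomposable (r + s) (join (block_edges As) G') (1 * b')"
      by (rule decomposable_Un.IH(2)) (use decomposable_Un.prems in auto)
    ultimately show ?case
      using decomposable.decomposable_Un by (fastforce simp: join_Un_right)
  qed
next
  case (decomposable_Un r F a F' a')
  have "join F G \<inter> join F' G = {}"
    by (rule join_disjoint[of _ _ _ _ "\<Union> (F \<union> F')" "\<Union> G"]) (use decomposable_Un in auto)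
  moreover have "decomposable (r + s) (join F G) (a * b)"
    by (rule decomposable_Un.IH(1)) (use decomposable_Un.prems in auto)
  moreover have "decomposable (r + s) (join F' G) (a' * b)"
    by (rule decomposable_Un.IH(2)) (use decomposable_Un.prems in auto)
  ultimately show ?case
    using decomposable.decomposable_Un by (simp add: join_Un_left add_mult_distrib)
qed

lemma decomposable_restrict:
  assumes "decomposable r F b"
  shows "decomposable r {e \<in> F. e \<subseteq> U} b"
  using assms
proof (induction rule: decomposable.induct)
  case (decomposable_empty r b)
  then show ?case by (simp add: decomposable.decomposable_empty)
next
  case (decomposable_block As r)
  have "{e \<in> block_edges As. e \<subseteq> U} = block_edges (map (\<lambda>A. A \<inter> U) As)"
  proof -
    have "list_all2 (\<in>) xs (map (\<lambda>A. A \<inter> U) As) \<longleftrightarrow> list_all2 (\<in>) xs As \<and> set xs \<subseteq> U" for xs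
      by (auto simp: list_all2_conv_all_nth in_set_conv_nth subset_iff)
    then show ?thesis by (auto simp: block_edges_def)
  qed
  moreover have "sorted_wrt disjnt (map (\<lambda>A. A \<inter> U) As)"
    using decomposable_block(2) by (simp add: sorted_wrt_map) (rule sorted_wrt_mono_rel[rotated], assumption, auto simp: disjnt_def)
  ultimately show ?case
    using decomposable.decomposable_block[of "map (\<lambda>A. A \<inter> U) As" r] decomposable_block by simp
next
  case (decomposable_Un r F a G b)
  have "{e \<in> F \<union> G. e \<subseteq> U} = {e \<in> F. e \<subseteq> U} \<union> {e \<in> G. e \<subseteq> U}" by auto
  moreover have "{e \<in> F. e \<subseteq> U} \<inter> {e \<in> G. e \<subseteq> U} = {}"
    using decomposable_Un.hyps(3) by auto
  ultimately show ?case
    using decomposable.decomposable_Un[OF decomposable_Un.IH] by simp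
qed

lemma decomposable_image:
  assumes "decomposable r F b" "inj_on f (\<Union> F)"
  shows "decomposable r ((`) f ` F) b"
  using assms
proof (induction rule: decomposable.induct)
  case (decomposable_empty r b)
  then show ?case by (simp add: decomposable.decomposable_empty)
next
  case (decomposable_block As r)
  show ?case
  proof (cases "block_edges As = {}")
    case True
    then show ?thesis by (simp add: decomposable.decomposable_empty)
  next
    case False
    then have inj: "inj_on f (\<Union> (set As))"
      using decomposable_block.prems by (simp add: Union_block_edges)
    have "(`) f ` block_edges As = block_edges (map ((`) f) As)"
    proof (intro equalityI subsetI)
      fix e assume "e \<in> (`) f ` block_edges As"
      then obtain xs where "list_all2 (\<in>) xs As" "e = f ` set xs" by (auto simp: block_edges_def)
      then show "e \<in> block_edges (map ((`) f) As)"
        by (auto simp: block_edges_def list_all2_conv_all_nth intro!: exI[of _ "map f xs"])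
    next
      fix e assume "e \<in> block_edges (map ((`) f) As)"
      then obtain ys where ys: "list_all2 (\<in>) ys (map ((`) f) As)" "e = set ys"
        by (auto simp: block_edges_def)
      then have "\<forall>i<length As. \<exists>x. x \<in> As ! i \<and> ys ! i = f x" and len: "length ys = length As"
        by (auto simp: list_all2_conv_all_nth image_iff Bex_def)
      then obtain g where g: "\<forall>i<length As. g i \<in> As ! i \<and> ys ! i = f (g i)" by metis
      have "list_all2 (\<in>) (map g [0..<length As]) As" "map f (map g [0..<length As]) = ys"
        using g len by (auto simp: list_all2_conv_all_nth intro!: nth_equalityI)
      then have "set ys = f ` set (map g [0..<length As])" "set (map g [0..<length As]) \<in> block_edges As"
        unfolding block_edges_def by (metis set_map, blast)
      then show "e \<in> (`) f ` block_edges As"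
        using ys by blast
    qed
    moreover have "sorted_wrt disjnt (map ((`) f) As)"
      using decomposable_block(2) inj
    proof (induction As)
      case (Cons A As)
      have "f ` A \<inter> f ` B = {}" if "B \<in> set As" for B
      proof -
        have "A \<inter> B = {}" using Cons.prems(1) that by (auto simp: disjnt_def)
        then show ?thesis
          using inj_on_image_Int[OF Cons.prems(2), of A B] that by auto
      qed
      moreover have "inj_on f (\<Union> (set As))" using Cons.prems(2) by (auto intro: inj_on_subset)
      ultimately show ?case using Cons by (auto simp: disjnt_def)
    qed simp
    ultimately show ?thesis
      using decomposable.decomposable_block[of "map ((`) f) As" r] decomposable_block by simp
  qed
next
  case (decomposable_Un r F a G b)
  have "(`) f ` F \<inter> (`) f ` G = {}"
  proof -
    have "e = e'" if "e \<in> F" "e' \<in> G" "f ` e = f ` e'" for e e'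
      using inj_on_image_eq_iff[OF decomposable_Un.prems, of e e'] that by auto
    with decomposable_Un.hyps(3) have "\<not> (e \<in> F \<and> e' \<in> G \<and> f ` e = f ` e')" for e e' by blast
    then show ?thesis unfolding disjoint_iff image_iff by metis
  qed
  moreover have "inj_on f (\<Union> F)" "inj_on f (\<Union> G)"
    using decomposable_Un.prems by (auto simp: inj_on_def)
  ultimately show ?case
    using decomposable.decomposable_Un decomposable_Un.IH by (simp add: image_Un)
qed

text \<open>
  An edge of the block list picks one vertex from each part; the parts being disjoint, these are \<open>r\<close>
  different vertices, so the edge meets each part once. Conversely an \<open>r\<close>-set meeting each of the
  \<open>r\<close> parts once has no further vertices.
\<close>

lemma block_edges_is_block:
  assumes "length As = r" "sorted_wrt disjnt As" "block_edges As \<noteq> {}" "\<Union> (block_edges As) \<subseteq> V"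
  shows "is_block r V (block_edges As)"
proof -
  have disj: "As ! i \<inter> As ! j = {}" if "i < r" "j < r" "i \<noteq> j" for i j
    using sorted_wrt_nth_less[OF assms(2), of i j] sorted_wrt_nth_less[OF assms(2), of j i] that assms(1)
    by (cases "i < j") (auto simp: disjnt_def)
  have sub: "As ! i \<subseteq> V" if "i < r" for i
    using Union_block_edges[OF assms(3)] assms(1,4) nth_mem[of i As] that by blast
  have ne: "As ! i \<noteq> {}" if "i < r" for i
    using assms(1,3) that by (auto simp: block_edges_def list_all2_conv_all_nth)
  have "block_edges As = multipartite_edges r V ((!) As)"
  proof (intro equalityI subsetI)
    fix e assume "e \<in> block_edges As"
    then obtain xs where xs: "length xs = r" "\<And>i. i < r \<Longrightarrow> xs ! i \<in> As ! i" "e = set xs"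
      using assms(1) by (auto simp: block_edges_def list_all2_conv_all_nth)
    have "distinct xs"
      unfolding distinct_conv_nth using xs(1,2) disj by (metis disjoint_iff)
    moreover have "e \<inter> As ! i = {xs ! i}" if "i < r" for i
    proof -
      have "x = xs ! i" if "x \<in> set xs" "x \<in> As ! i" for x
      proof -
        from that(1) obtain j where j: "j < r" "x = xs ! j" using xs by (auto simp: in_set_conv_nth)
        then show ?thesis using xs(2)[of j] disj[of i j] that(2) \<open>i < r\<close> by auto
      qed
      then show ?thesis using xs that by auto
    qed
    ultimately show "e \<in> multipartite_edges r V ((!) As)"
      using xs(1,3) subsetD[OF sub xs(2)]
      by (auto simp: multipartite_edges_def nsets_def distinct_card in_set_conv_nth)
  next
    fix e assume "e \<in> multipartite_edges r V ((!) As)"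
    then have e: "finite e" "card e = r" "\<And>i. i < r \<Longrightarrow> \<exists>x. e \<inter> As ! i = {x}"
      by (auto simp: multipartite_edges_def nsets_def card_1_singleton_iff)
    then obtain g where g: "\<And>i. i < r \<Longrightarrow> e \<inter> As ! i = {g i}" by metis
    have "inj_on g {..<r}"
    proof (rule inj_onI)
      fix i j assume "i \<in> {..<r}" "j \<in> {..<r}" "g i = g j"
      then show "i = j" using g[of i] g[of j] disj[of i j] by auto
    qed
    moreover have "g ` {..<r} \<subseteq> e" using g by auto
    ultimately have "e = g ` {..<r}"
      using e by (metis card_image card_lessThan card_subset_eq)
    moreover have "g i \<in> As ! i" if "i < r" for i using g[OF that] by auto
    ultimately have "list_all2 (\<in>) (map g [0..<r]) As" "e = set (map g [0..<r])"
      using assms(1) by (simp_all add: list_all2_conv_all_nth atLeast0LessThan)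
    then show "e \<in> block_edges As" unfolding block_edges_def by blast
  qed
  then show ?thesis
    using disj sub ne unfolding is_block_def disjoint_family_on_def by (intro exI[of _ "(!) As"]) auto
qed

lemma decomposable_partition:
  assumes "decomposable r F b" "\<Union> F \<subseteq> V"
  shows "\<exists>\<B>. finite \<B> \<and> card \<B> \<le> b \<and> (\<forall>E\<in>\<B>. is_block r V E) \<and> partition_on F \<B>"
  using assms
proof (induction rule: decomposable.induct)
  case (decomposable_empty r b)
  then show ?case by (intro exI[of _ "{}"]) (auto simp: partition_on_def)
next
  case (decomposable_block As r)
  show ?case
  proof (cases "block_edges As = {}")
    case True
    then show ?thesis by (intro exI[of _ "{}"]) (auto simp: partition_on_def)
  next
    case False
    then show ?thesis
      using decomposable_block
      by (intro exI[of _ "{block_edges As}"]) (auto simp: partition_on_def block_edges_is_block)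
  qed
next
  case (decomposable_Un r F a G b)
  then obtain \<B> \<C> where
    B: "finite \<B>" "card \<B> \<le> a" "\<forall>E\<in>\<B>. is_block r V E" "partition_on F \<B>" and
    C: "finite \<C>" "card \<C> \<le> b" "\<forall>E\<in>\<C>. is_block r V E" "partition_on G \<C>" by auto
  have "partition_on (F \<union> G) (\<B> \<union> \<C>)"
    using B(4) C(4) decomposable_Un.hyps(3) disjoint_union[of \<B> \<C>]
    by (auto simp: partition_on_def)
  then show ?case
    using B C card_Un_le[of \<B> \<C>] by (intro exI[of _ "\<B> \<union> \<C>"]) auto
qed

section \<open>Complete hypergraphs\<close>

text \<open>
  Sort an edge by its second largest vertex \<open>v\<close>. What remains is an arbitrary edge below \<open>v\<close> together
  with one arbitrary vertex above \<open>v\<close>, so two vertices of the edge are paid for by the single choice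
  of \<open>v\<close>.
\<close>

lemma nsets_step:
  fixes V :: "nat set"
  assumes "finite V"
  shows "nsets V (Suc (Suc r)) =
    (\<Union>v\<in>V. join (nsets (V \<inter> {..<v}) r) (block_edges [{v}, V \<inter> {v<..}]))"
proof (intro equalityI subsetI)
  fix e assume "e \<in> nsets V (Suc (Suc r))"
  then have e: "e \<subseteq> V" "finite e" "card e = Suc (Suc r)" by (auto simp: nsets_def)
  define w where "w = Max e"
  define v where "v = Max (e - {w})"
  have ne: "e \<noteq> {}" using e by auto
  have w: "w \<in> e" unfolding w_def using e ne by (intro Max_in) auto
  then have "card (e - {w}) = Suc r" using e by simp
  then have ne': "e - {w} \<noteq> {}" by (metis card.empty nat.distinct(1))
  have v: "v \<in> e - {w}" unfolding v_def using e ne' by (intro Max_in) auto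
  have vw: "v < w" using v e(2) by (auto simp: w_def order_less_le)
  have d: "e - {w} - {v} \<in> nsets (V \<inter> {..<v}) r"
  proof -
    have "x < v" if "x \<in> e - {w} - {v}" for x
      using that e Max_ge[of "e - {w}" x] by (auto simp: v_def[symmetric] le_less)
    then show ?thesis using e v w by (auto simp: nsets_def)
  qed
  have eq: "e = (e - {w} - {v}) \<union> {v, w}" using v w by auto
  show "e \<in> (\<Union>v\<in>V. join (nsets (V \<inter> {..<v}) r) (block_edges [{v}, V \<inter> {v<..}]))"
  proof -
    have "{v, w} \<in> block_edges [{v}, V \<inter> {v<..}]"
      using vw e w unfolding block_edges_pair by blast
    then have "e \<in> join (nsets (V \<inter> {..<v}) r) (block_edges [{v}, V \<inter> {v<..}])"
      using d eq unfolding join_def by blast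
    then show ?thesis using e v by blast
  qed
next
  fix e assume "e \<in> (\<Union>v\<in>V. join (nsets (V \<inter> {..<v}) r) (block_edges [{v}, V \<inter> {v<..}]))"
  then obtain v w d where "v \<in> V" "d \<in> nsets (V \<inter> {..<v}) r" "w \<in> V" "v < w" "e = d \<union> {v, w}"
    unfolding join_def block_edges_pair by auto
  moreover from this have "v \<notin> d" "w \<notin> d" by (auto simp: nsets_def)
  ultimately show "e \<in> nsets V (Suc (Suc r))" by (auto simp: nsets_def)
qed

lemma nsets_step_disjoint:
  fixes V :: "nat set"
  assumes "finite V"
  shows "disjoint_family_on (\<lambda>v. join (nsets (V \<inter> {..<v}) r) (block_edges [{v}, V \<inter> {v<..}])) V"
proof -
  have "Max (e - {Max e}) = v"
    if "e \<in> join (nsets (V \<inter> {..<v}) r) (block_edges [{v}, V \<inter> {v<..}])" for v e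
  proof -
    from that obtain w d where d: "d \<subseteq> {..<v}" "finite d" "v < w" "e = d \<union> {v, w}"
      unfolding join_def block_edges_pair nsets_def by auto
    have "Max e = w" using d by (intro Max_eqI) auto
    moreover have "e - {w} = insert v d" using d by auto
    moreover have "Max (insert v d) = v" using d by (intro Max_eqI) auto
    ultimately show ?thesis by simp
  qed
  then show ?thesis unfolding disjoint_family_on_def disjoint_iff by metis
qed

text \<open>
  This is the classical bound of order \<open>n ^ (r div 2)\<close>, with a constant that is too weak for the main
  term but good enough for every lower order term.
\<close>

lemma decomposable_nsets:
  fixes V :: "nat set"
  assumes "finite V"
  shows "decomposable r (nsets V r) (card V ^ (r div 2))"
  using assms
proof (induction r arbitrary: V rule: induct_nat_012)
  case 0
  have "nsets V 0 = block_edges []" by (auto simp: nsets_def block_edges_Nil)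
  then show ?case using decomposable_block[of "[]" 0] by simp
next
  case 1
  have "nsets V (Suc 0) = block_edges [V]"
    by (auto simp: nsets_def block_edges_single card_Suc_eq)
  then show ?case using decomposable_block[of "[V]" "Suc 0"] by simp
next
  case (ge2 r)
  have "decomposable (Suc (Suc r))
      (\<Union>v\<in>V. join (nsets (V \<inter> {..<v}) r) (block_edges [{v}, V \<inter> {v<..}]))
      (\<Sum>v\<in>V. card V ^ (r div 2))"
  proof (intro decomposable_UN nsets_step_disjoint)
    fix v assume "v \<in> V"
    have "decomposable r (nsets (V \<inter> {..<v}) r) (card V ^ (r div 2))"
      using ge2 by (intro decomposable_mono[OF ge2.IH(1)] power_mono card_mono) auto
    moreover have "decomposable 2 (block_edges [{v}, V \<inter> {v<..}]) 1"
      by (rule decomposable_block) (auto simp: disjnt_def)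
    moreover have "\<Union> (nsets (V \<inter> {..<v}) r) \<inter> \<Union> (block_edges [{v}, V \<inter> {v<..}]) = {}"
      by (auto simp: nsets_def block_edges_pair)
    ultimately show "decomposable (Suc (Suc r))
        (join (nsets (V \<inter> {..<v}) r) (block_edges [{v}, V \<inter> {v<..}])) (card V ^ (r div 2))"
      using decomposable_join[of r _ _ 2 _ 1] by simp
  qed (use ge2 in auto)
  then show ?case using ge2 by (simp add: nsets_step)
qed

text \<open>
  For complete hypergraphs this number is at least the block number (the two are in fact the same
  quantity), and it is easier to bound because of the closure properties above.
\<close>

definition dec_number :: "nat \<Rightarrow> nat \<Rightarrow> nat" where
  "dec_number r n = (LEAST b. decomposable r (nsets {..<n} r) b)"

lemma decomposable_dec_number: "decomposable r (nsets {..<n} r) (dec_number r n)"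
  unfolding dec_number_def by (rule LeastI) (rule decomposable_nsets, simp)

lemma dec_number_le: "decomposable r (nsets {..<n} r) b \<Longrightarrow> dec_number r n \<le> b"
  unfolding dec_number_def by (rule Least_le)

lemma dec_number_le_power: "dec_number r n \<le> n ^ (r div 2)"
  using dec_number_le[OF decomposable_nsets] by (metis card_lessThan finite_lessThan)

lemma dec_number_mono:
  assumes "m \<le> n"
  shows "dec_number r m \<le> dec_number r n"
proof (rule dec_number_le)
  have "nsets {..<m} r = {e \<in> nsets {..<n} r. e \<subseteq> {..<m}}"
    using assms by (auto simp: nsets_def)
  then show "decomposable r (nsets {..<m} r) (dec_number r n)"
    using decomposable_restrict[OF decomposable_dec_number] by metis
qed

lemma block_number_le_dec_number: "block_number r n \<le> dec_number r n"
proof -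
  obtain \<B> where "finite \<B>" "card \<B> \<le> dec_number r n" "\<forall>E\<in>\<B>. is_block r {..<n} E"
    "partition_on (nsets {..<n} r) \<B>"
    using decomposable_partition[OF decomposable_dec_number[of r n], of "{..<n}"] by (auto simp: nsets_def)
  moreover from this have "block_number r n \<le> card \<B>"
    unfolding block_number_def by (intro Least_le) (auto simp: block_partition_def)
  ultimately show ?thesis by simp
qed

lemma nsets_Un:
  assumes "U \<inter> W = {}"
  shows "nsets (U \<union> W) r = (\<Union>a\<in>{..r}. join (nsets U (r - a)) (nsets W a))"
proof (intro equalityI subsetI)
  fix e assume "e \<in> nsets (U \<union> W) r"
  then have e: "e \<subseteq> U \<union> W" "finite e" "card e = r" by (auto simp: nsets_def)
  have eq: "e = (e \<inter> U) \<union> (e \<inter> W)" using e by auto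
  have "card e = card (e \<inter> U) + card (e \<inter> W)"
    using e assms by (subst eq, intro card_Un_disjoint) auto
  then have "e \<inter> U \<in> nsets U (r - card (e \<inter> W))" "e \<inter> W \<in> nsets W (card (e \<inter> W))" "card (e \<inter> W) \<le> r"
    using e by (auto simp: nsets_def)
  then show "e \<in> (\<Union>a\<in>{..r}. join (nsets U (r - a)) (nsets W a))"
    unfolding join_def using eq by blast
next
  fix e assume "e \<in> (\<Union>a\<in>{..r}. join (nsets U (r - a)) (nsets W a))"
  then obtain a d f where *: "a \<le> r" "d \<in> nsets U (r - a)" "f \<in> nsets W a" "e = d \<union> f"
    by (auto simp: join_def)
  then have "d \<inter> f = {}" using assms by (auto simp: nsets_def)
  then show "e \<in> nsets (U \<union> W) r"
    using * by (auto simp: nsets_def card_Un_disjoint)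
qed

lemma join_nsets_disjoint_family:
  assumes "U \<inter> W = {}"
  shows "disjoint_family_on (\<lambda>a::nat. join (nsets U (r - a)) (nsets W a)) I"
  unfolding disjoint_family_on_def
proof (intro ballI impI)
  fix a b :: nat assume "a \<noteq> b"
  then have "nsets W a \<inter> nsets W b = {}" by (auto simp: nsets_def)
  then show "join (nsets U (r - a)) (nsets W a) \<inter> join (nsets U (r - b)) (nsets W b) = {}"
    using assms by (intro join_disjoint[of _ _ _ _ U W]) (auto simp: nsets_def)
qed

lemma nsets_0: "nsets V 0 = {{}}"
  by (auto simp: nsets_def)

text \<open>
  The vertices are cut into \<open>N\<close> consecutive intervals of length \<open>s\<close>. An edge is classified by the
  last interval \<open>j\<close> that it meets and by the number \<open>a\<close> of its vertices there; the other \<open>r - a\<close>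
  vertices form an arbitrary edge below that interval. The factor \<open>G\<close> makes it possible to use the
  lemma a second time, on the edges that remain below the last interval.
\<close>

lemma decomposable_intervals:
  fixes s :: nat
  assumes "r > 0"
    and "\<And>j a. j < N \<Longrightarrow> a \<in> {1..r} \<Longrightarrow>
      decomposable t (join (join (nsets {..<j * s} (r - a)) (nsets {j * s..<Suc j * s} a)) G) (b j a)"
    and "\<Union> G \<inter> {..<N * s} = {}"
  shows "decomposable t (join (nsets {..<N * s} r) G) (\<Sum>j<N. \<Sum>a\<in>{1..r}. b j a)"
  using assms(2,3)
proof (induction N)
  case 0
  have "nsets ({} :: nat set) r = {}" using assms(1) by (auto simp: nsets_def)
  then have "nsets {..<0 * s} r = {}" by (simp add: lessThan_0)
  then show ?case by (simp only: join_empty_left decomposable_empty)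
next
  case (Suc N)
  let ?H = "\<lambda>a. join (nsets {..<N * s} (r - a)) (nsets {N * s..<Suc N * s} a)"
  have split: "{..<Suc N * s} = {..<N * s} \<union> {N * s..<Suc N * s}" by auto
  have disj: "{..<N * s} \<inter> {N * s..<Suc N * s} = {}" by auto
  have fam: "disjoint_family_on ?H I" for I
    by (rule join_nsets_disjoint_family[OF disj])
  have atMost: "{..r} = insert 0 {1..r}" by auto
  have eq: "nsets {..<Suc N * s} r = nsets {..<N * s} r \<union> (\<Union>a\<in>{1..r}. ?H a)"
    unfolding split nsets_Un[OF disj] atMost by (simp add: nsets_0 join_unit)
  have G: "\<Union> G \<subseteq> - {..<Suc N * s}" using Suc.prems(2) by auto
  have sub: "\<Union> (?H a) \<subseteq> {..<Suc N * s}" for a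
    using Union_join[of "nsets {..<N * s} (r - a)" "nsets {N * s..<Suc N * s} a"]
    by (fastforce simp: nsets_def)
  have "disjoint_family_on (\<lambda>a. join (?H a) G) {1..r}"
    unfolding disjoint_family_on_def
  proof (intro ballI impI)
    fix a b assume "a \<in> {1..r}" "b \<in> {1..r}" "a \<noteq> b"
    then have "?H a \<inter> ?H b = {}" using fam[of UNIV] by (simp add: disjoint_family_on_def)
    then show "join (?H a) G \<inter> join (?H b) G = {}"
      by (intro join_disjoint[OF _ sub sub G G]) auto
  qed
  then have "decomposable t (\<Union>a\<in>{1..r}. join (?H a) G) (\<Sum>a\<in>{1..r}. b N a)"
    by (intro decomposable_UN Suc.prems(1)) auto
  moreover have "decomposable t (join (nsets {..<N * s} r) G) (\<Sum>j<N. \<Sum>a\<in>{1..r}. b j a)"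
  proof (rule Suc.IH)
    show "\<Union> G \<inter> {..<N * s} = {}" using Suc.prems(2) by auto
  qed (use Suc.prems(1) in simp)
  moreover have "join (nsets {..<N * s} r) G \<inter> (\<Union>a\<in>{1..r}. join (?H a) G) = {}"
  proof -
    have "join (nsets {..<N * s} r) G \<inter> join (?H a) G = {}" if "a \<in> {1..r}" for a
    proof (rule join_disjoint[OF _ _ sub G G])
      have "?H 0 \<inter> ?H a = {}"
        by (rule disjoint_family_onD[OF fam[of UNIV]]) (use that in auto)
      then show "nsets {..<N * s} r \<inter> ?H a = {} \<or> G \<inter> G = {}"
        by (simp add: nsets_0 join_unit)
    qed (auto simp: nsets_def)
    then show ?thesis by blast
  qed
  ultimately show ?case
    unfolding eq join_Un_left join_UN_left by (simp add: decomposable_Un)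
qed

lemma image_join: "(`) f ` join F G = join ((`) f ` F) ((`) f ` G)"
proof (intro equalityI subsetI)
  fix x assume "x \<in> (`) f ` join F G"
  then obtain e g where "e \<in> F" "g \<in> G" "x = f ` e \<union> f ` g" by (auto simp: join_def image_Un)
  then show "x \<in> join ((`) f ` F) ((`) f ` G)" unfolding join_def by blast
next
  fix x assume "x \<in> join ((`) f ` F) ((`) f ` G)"
  then obtain e g where "e \<union> g \<in> join F G" "x = f ` (e \<union> g)"
    unfolding join_def by (auto simp: image_Un)
  then show "x \<in> (`) f ` join F G" by blast
qed

lemma image_nsets:
  assumes "inj_on f V"
  shows "(`) f ` nsets V r = nsets (f ` V) r"
  using bij_betw_nsets[OF inj_on_imp_bij_betw[OF assms], of r] by (simp add: bij_betw_def)

text \<open>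
  The cost of a product of two complete hypergraphs depends only on the sizes of the two vertex sets,
  so they may be arranged in whatever way is convenient.
\<close>

lemma decomposable_join_nsets_bij:
  assumes "decomposable t (join (nsets X r) (nsets Y s)) b" "bij_betw f X U" "bij_betw g Y W"
    "X \<inter> Y = {}" "U \<inter> W = {}"
  shows "decomposable t (join (nsets U r) (nsets W s)) b"
proof -
  define h where "h x = (if x \<in> X then f x else g x)" for x
  have hX: "bij_betw h X U"
    using assms(2) by (rule iffD1[OF bij_betw_cong, rotated]) (simp add: h_def)
  have hY: "bij_betw h Y W"
    using assms(3) by (rule iffD1[OF bij_betw_cong, rotated]) (use assms(4) in \<open>auto simp: h_def\<close>)
  have h: "inj_on h X" "inj_on h Y" "h ` X = U" "h ` Y = W"
    using hX hY by (simp_all only: bij_betw_def)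
  have inj: "inj_on h (X \<union> Y)"
    by (rule bij_betw_imp_inj_on[OF bij_betw_combine[OF hX hY assms(5)]])
  have "inj_on h (\<Union> (join (nsets X r) (nsets Y s)))"
    by (rule inj_on_subset[OF inj])
       (rule order_trans[OF Union_join], auto simp: nsets_def)
  from decomposable_image[OF assms(1) this] show ?thesis
    by (simp only: image_join image_nsets[OF h(1)] image_nsets[OF h(2)] h(3,4))
qed

section \<open>Comparison with binomial coefficients\<close>

lemma power_over_binomial_tendsto:
  "(\<lambda>n. real n ^ k / (fact k * real (n choose k))) \<longlonglongrightarrow> 1"
proof -
  have "(\<lambda>n. \<Prod>i<k. 1 / (1 - real i / real n)) \<longlonglongrightarrow> (\<Prod>i<k. 1 / (1 - 0))"
    by (intro tendsto_intros lim_const_over_n) auto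
  then have "(\<lambda>n. \<Prod>i<k. 1 / (1 - real i / real n)) \<longlonglongrightarrow> 1" by simp
  moreover have "eventually (\<lambda>n. (\<Prod>i<k. 1 / (1 - real i / real n)) =
      real n ^ k / (fact k * real (n choose k))) sequentially"
    using eventually_ge_at_top[of "Suc k"]
  proof eventually_elim
    case (elim n)
    have "fact k * real (n choose k) = (\<Prod>i<k. real n - real i)"
      by (simp add: binomial_gbinomial gbinomial_prod_rev atLeast0LessThan)
    moreover have "(\<Prod>i<k. 1 / (1 - real i / real n)) = (\<Prod>i<k. real n / (real n - real i))"
      using elim by (intro prod.cong) (auto simp: field_simps)
    ultimately show ?case by (simp add: prod_dividef)
  qed
  ultimately show ?thesis by (rule Lim_transform_eventually)
qed

text \<open>
  The binomial coefficient is asymptotic to \<open>n ^ k / fact k\<close> but smaller; the quotient of the two is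
  absorbed by the error term. For \<open>n < k\<close> the right-hand side vanishes, so the left-hand side must not
  be positive there.
\<close>

lemma power_bound_imp_binomial_bound:
  fixes f :: "nat \<Rightarrow> real" and A C :: real
  assumes "0 < A" "C \<le> A"
    and f: "eventually (\<lambda>n. f n \<le> C / fact k * real n ^ k) sequentially"
    and small: "\<And>n. n < k \<Longrightarrow> f n \<le> 0"
  shows "\<exists>\<epsilon>. \<epsilon> \<in> o(\<lambda>n. 1) \<and> (\<forall>n. f n \<le> A * (1 + \<epsilon> n) * real (n choose k))"
proof -
  define Q where "Q n = real n ^ k / (fact k * real (n choose k))" for n
  define \<epsilon> where "\<epsilon> n = max 0 (f n / (A * real (n choose k)) - 1)" for n
  have "eventually (\<lambda>n. \<epsilon> n \<le> max 0 (Q n - 1)) sequentially"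
    using f eventually_ge_at_top[of k]
  proof eventually_elim
    case (elim n)
    have pos: "A * real (n choose k) > 0" using assms(1) elim(2) by simp
    have "C / fact k * real n ^ k \<le> A / fact k * real n ^ k"
      using assms(2) by (intro mult_right_mono divide_right_mono) auto
    with elim(1) have "f n / (A * real (n choose k)) \<le> A / fact k * real n ^ k / (A * real (n choose k))"
      using pos by (intro divide_right_mono) auto
    also have "\<dots> = Q n" using assms(1) by (simp add: Q_def)
    finally show ?case by (auto simp: \<epsilon>_def)
  qed
  moreover have "eventually (\<lambda>n. 0 \<le> \<epsilon> n) sequentially" by (simp add: \<epsilon>_def)
  moreover have "(\<lambda>n. max 0 (Q n - 1)) \<longlonglongrightarrow> max 0 (1 - 1)"
    unfolding Q_def by (intro tendsto_intros power_over_binomial_tendsto)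
  ultimately have "\<epsilon> \<longlonglongrightarrow> 0"
    by (intro tendsto_sandwich[of "\<lambda>_. 0" \<epsilon> _ "\<lambda>n. max 0 (Q n - 1)"]) auto
  then have "\<epsilon> \<in> o(\<lambda>n. 1)" by (intro smalloI_tendsto) auto
  moreover have "f n \<le> A * (1 + \<epsilon> n) * real (n choose k)" for n
  proof (cases "k \<le> n")
    case True
    then have "A * real (n choose k) > 0" using assms(1) by simp
    moreover have "f n / (A * real (n choose k)) \<le> 1 + \<epsilon> n" by (simp add: \<epsilon>_def)
    ultimately show ?thesis by (simp add: divide_le_eq mult_ac)
  next
    case False
    then have "n < k" by simp
    with small[OF this] show ?thesis by (simp add: binomial_eq_0)
  qed
  ultimately show ?thesis by blast
qed

lemma block_number_eq_0: "n < r \<Longrightarrow> block_number r n = 0"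
  using dec_number_le[of r n 0] block_number_le_dec_number[of r n]
  by (simp add: nsets_eq_empty decomposable_empty)

section \<open>Adding four vertices to an edge\<close>

lemma Union_nsets: "\<Union> (nsets V a) \<subseteq> V"
  by (auto simp: nsets_def)

text \<open>
  The edges are classified by the last two intervals that they meet. If both contain exactly two
  vertices, these four vertices are handled together, at a cost of \<open>\<beta>\<close> that is supplied as an
  assumption, and the rest is an arbitrary edge with four vertices fewer. In all other cases the
  intervals are treated independently.
\<close>

lemma dec_number_intervals:
  fixes k s N \<beta> :: nat
  assumes pairs: "\<And>U W :: nat set. finite U \<Longrightarrow> finite W \<Longrightarrow> card U = s \<Longrightarrow> card W = s \<Longrightarrow> U \<inter> W = {} \<Longrightarrow>
    decomposable 4 (join (nsets U 2) (nsets W 2)) \<beta>"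
  shows "dec_number (2 * k + 4) (N * s) \<le>
    (\<Sum>j<N. \<Sum>a\<in>{1..2 * k + 4}. if a = 2
       then \<Sum>i<j. \<Sum>b\<in>{1..2 * k + 2}. if b = 2
         then dec_number (2 * k) (i * s) * \<beta>
         else dec_number (2 * k + 2 - b) (i * s) * s ^ (b div 2) * s
       else dec_number (2 * k + 4 - a) (j * s) * s ^ (a div 2))"
proof (rule dec_number_le)
  let ?I = "\<lambda>j. {j * s..<Suc j * s}"
  have interval: "decomposable a (nsets (?I j) a) (s ^ (a div 2))" for a j
    using decomposable_nsets[of "?I j" a] by simp
  have sub: "\<Union> (nsets {..<j * s} a) \<inter> \<Union> (nsets (?I j) b) = {}" for j a b
  proof -
    have "{..<j * s} \<inter> ?I j = {}" by auto
    then show ?thesis using Union_nsets[of "{..<j * s}" a] Union_nsets[of "?I j" b] by blast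
  qed
  have step: "decomposable t (join (nsets {..<j * s} c) (nsets (?I j) a)) (dec_number c (j * s) * s ^ (a div 2))"
    if "t = c + a" for t c a j
    unfolding that by (intro decomposable_join decomposable_dec_number interval sub)
  have inner: "decomposable (2 * k + 4) (join (nsets {..<j * s} (2 * k + 2)) (nsets (?I j) 2))
      (\<Sum>i<j. \<Sum>b\<in>{1..2 * k + 2}. if b = 2
         then dec_number (2 * k) (i * s) * \<beta>
         else dec_number (2 * k + 2 - b) (i * s) * s ^ (b div 2) * s)" for j
  proof (rule decomposable_intervals)
    fix i b assume ib: "i < j" "b \<in> {1..2 * k + 2}"
    then have "Suc i * s \<le> j * s" by (intro mult_right_mono) auto
    then have far: "?I i \<inter> ?I j = {}" "{..<i * s} \<inter> ?I j = {}" by auto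
    show "decomposable (2 * k + 4)
        (join (join (nsets {..<i * s} (2 * k + 2 - b)) (nsets (?I i) b)) (nsets (?I j) 2))
        (if b = 2 then dec_number (2 * k) (i * s) * \<beta>
         else dec_number (2 * k + 2 - b) (i * s) * s ^ (b div 2) * s)"
    proof (cases "b = 2")
      case True
      have "decomposable 4 (join (nsets (?I i) 2) (nsets (?I j) 2)) \<beta>"
        by (rule pairs) (use far in auto)
      moreover have "\<Union> (nsets {..<i * s} (2 * k)) \<inter> \<Union> (join (nsets (?I i) 2) (nsets (?I j) 2)) = {}"
      proof -
        have "{..<i * s} \<inter> (?I i \<union> ?I j) = {}" using far(2) by auto
        then show ?thesis
          using Union_join[of "nsets (?I i) 2" "nsets (?I j) 2"] Union_nsets[of "?I i" 2]
            Union_nsets[of "?I j" 2] Union_nsets[of "{..<i * s}" "2 * k"] by blast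
      qed
      ultimately have "decomposable (2 * k + 4)
          (join (nsets {..<i * s} (2 * k)) (join (nsets (?I i) 2) (nsets (?I j) 2)))
          (dec_number (2 * k) (i * s) * \<beta>)"
        by (intro decomposable_join decomposable_dec_number)
      then show ?thesis using True by (simp add: join_assoc)
    next
      case False
      have "\<Union> (join (nsets {..<i * s} (2 * k + 2 - b)) (nsets (?I i) b)) \<inter> \<Union> (nsets (?I j) 2) = {}"
        using far Union_join[of "nsets {..<i * s} (2 * k + 2 - b)" "nsets (?I i) b"]
          Union_nsets[of "{..<i * s}" "2 * k + 2 - b"] Union_nsets[of "?I i" b] Union_nsets[of "?I j" 2]
        by blast
      then have "decomposable (2 * k + 2 + 2)
          (join (join (nsets {..<i * s} (2 * k + 2 - b)) (nsets (?I i) b)) (nsets (?I j) 2))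
          (dec_number (2 * k + 2 - b) (i * s) * s ^ (b div 2) * s ^ (2 div 2))"
        using ib(2) by (intro decomposable_join[OF step] interval) auto
      moreover have "2 * k + 2 + 2 = 2 * k + 4" "s ^ (2 div 2) = s" by simp_all
      ultimately show ?thesis by (simp only: False if_False)
    qed
  next
    have "{..<j * s} \<inter> ?I j = {}" by auto
    then show "\<Union> (nsets (?I j) 2) \<inter> {..<j * s} = {}" using Union_nsets[of "?I j" 2] by blast
  qed simp
  have "decomposable (2 * k + 4) (join (nsets {..<N * s} (2 * k + 4)) {{}})
    (\<Sum>j<N. \<Sum>a\<in>{1..2 * k + 4}. if a = 2
       then \<Sum>i<j. \<Sum>b\<in>{1..2 * k + 2}. if b = 2
         then dec_number (2 * k) (i * s) * \<beta>
         else dec_number (2 * k + 2 - b) (i * s) * s ^ (b div 2) * s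
       else dec_number (2 * k + 4 - a) (j * s) * s ^ (a div 2))"
  proof (rule decomposable_intervals)
    fix j a assume "j < N" "a \<in> {1..2 * k + 4}"
    then show "decomposable (2 * k + 4)
        (join (join (nsets {..<j * s} (2 * k + 4 - a)) (nsets (?I j) a)) {{}})
        (if a = 2
       then \<Sum>i<j. \<Sum>b\<in>{1..2 * k + 2}. if b = 2
         then dec_number (2 * k) (i * s) * \<beta>
         else dec_number (2 * k + 2 - b) (i * s) * s ^ (b div 2) * s
       else dec_number (2 * k + 4 - a) (j * s) * s ^ (a div 2))"
      using inner[of j] step[of "2 * k + 4" "2 * k + 4 - a" a j] by (auto simp: join_unit)
  qed auto
  then show "decomposable (2 * k + 4) (nsets {..<N * s} (2 * k + 4)) \<dots>"
    by (simp add: join_unit)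
qed

lemma sum_power_le: "(\<Sum>i<j. real i ^ k) \<le> real j ^ (k + 1) / (k + 1)"
proof (induction j)
  case (Suc j)
  have "x ^ Suc n + (real n + 1) * x ^ n \<le> (x + 1) ^ Suc n" if "x \<ge> 0" for x :: real and n
  proof (induction n)
    case (Suc n)
    have "x ^ Suc (Suc n) + (real (Suc n) + 1) * x ^ Suc n \<le> (x + 1) * (x ^ Suc n + (real n + 1) * x ^ n)"
      using that by (simp add: algebra_simps)
    also have "\<dots> \<le> (x + 1) * (x + 1) ^ Suc n" using Suc that by (intro mult_left_mono) auto
    finally show ?case by simp
  qed simp
  from this[of "real j" k] Suc show ?case by (simp add: field_simps)
qed simp

lemma sum_sum_power_le: "(\<Sum>j<N. \<Sum>i<j. real i ^ k) \<le> real N ^ (k + 2) / ((k + 1) * (k + 2))"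
proof -
  have "(\<Sum>j<N. \<Sum>i<j. real i ^ k) \<le> (\<Sum>j<N. real j ^ (k + 1) / (k + 1))"
    by (intro sum_mono sum_power_le)
  also have "\<dots> = (\<Sum>j<N. real j ^ (k + 1)) / (k + 1)" by (simp add: sum_divide_distrib)
  also have "\<dots> \<le> real N ^ (k + 1 + 1) / (k + 1 + 1) / (k + 1)"
    by (intro divide_right_mono) (use sum_power_le[where j = N and k = "k + 1"] in auto)
  finally show ?thesis by (simp add: field_simps)
qed

text \<open>
  Why only the cases with exactly two vertices matter. If the number \<open>a\<close> of vertices in the last
  interval is odd, rounding loses a whole factor \<open>n\<close>. If \<open>a\<close> is even and at least 4, then at least two
  factors \<open>n\<close> are replaced by the interval length \<open>n / N\<close>; one factor \<open>N\<close> is lost again when summing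
  over the intervals, but not the second.
\<close>

lemma crude_term_le:
  assumes "j < N" "a \<in> {1..2 * l}" "a \<noteq> 2" "s > 0" "n = real N * real s"
  shows "real (dec_number (2 * l - a) (j * s) * s ^ (a div 2)) \<le> n ^ (l - 1) + n ^ l / real N ^ 2"
proof -
  have N: "real N \<ge> 1" "real s \<ge> 1" using assms by auto
  have s: "real s \<le> n" and js: "real (j * s) \<le> n"
    using assms N by (simp_all add: mult_right_mono)
  have n: "n \<ge> 1" using N s by linarith
  have "dec_number (2 * l - a) (j * s) \<le> (j * s) ^ ((2 * l - a) div 2)" by (rule dec_number_le_power)
  then have "real (dec_number (2 * l - a) (j * s)) \<le> real (j * s) ^ ((2 * l - a) div 2)"
    by (metis of_nat_le_iff of_nat_power)
  also have "\<dots> \<le> n ^ ((2 * l - a) div 2)" by (intro power_mono js) simp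
  finally have D: "real (dec_number (2 * l - a) (j * s)) \<le> n ^ ((2 * l - a) div 2)" .
  show ?thesis
  proof (cases "even a")
    case True
    then obtain c where c: "a = 2 * c" by blast
    then have c2: "2 \<le> c" "c \<le> l" using assms(2,3) by auto
    have "(2 * l - a) div 2 = l - c" using c by (simp add: diff_mult_distrib2[symmetric])
    then have "real (dec_number (2 * l - a) (j * s) * s ^ (a div 2)) \<le> n ^ (l - c) * real s ^ c"
      using D c by (simp add: mult_right_mono)
    also have "\<dots> = n ^ (l - c) * (n ^ c / real N ^ c)"
      using N assms(5) by (simp add: power_mult_distrib)
    also have "\<dots> = n ^ l / real N ^ c" using c2 by (simp add: power_add[symmetric])
    also have "\<dots> \<le> n ^ l / real N ^ 2"
      using N n c2 by (intro divide_left_mono power_increasing) auto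
    also have "\<dots> \<le> n ^ (l - 1) + n ^ l / real N ^ 2" using n by simp
    finally show ?thesis .
  next
    case False
    then obtain c where c: "a = 2 * c + 1" using oddE by blast
    have "(2 * l - a) div 2 + a div 2 = l - 1" using c assms(2) by auto
    moreover have "real (dec_number (2 * l - a) (j * s) * s ^ (a div 2)) \<le>
        n ^ ((2 * l - a) div 2) * n ^ (a div 2)"
      using D s n by (auto intro!: mult_mono power_mono)
    ultimately have "real (dec_number (2 * l - a) (j * s) * s ^ (a div 2)) \<le> n ^ (l - 1)"
      by (simp add: power_add[symmetric])
    also have "\<dots> \<le> n ^ (l - 1) + n ^ l / real N ^ 2" using n by simp
    finally show ?thesis .
  qed
qed

lemma sum_if_eq_2_le:
  fixes x e :: real
  assumes "e \<ge> 0"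
  shows "(\<Sum>a\<in>{1..2 * l}. if a = 2 then x else e) \<le> (if l = 0 then 0 else x) + 2 * real l * e"
proof -
  have "(\<Sum>a\<in>{1..2 * l}. if a = 2 then x else e) \<le> (\<Sum>a\<in>{1..2 * l}. (if a = 2 then x else 0) + e)"
    using assms by (intro sum_mono) auto
  also have "\<dots> = (if l = 0 then 0 else x) + 2 * real l * e"
    by (auto simp: sum.distrib sum.delta)
  finally show ?thesis .
qed

text \<open>
  The double sum over the two intervals carries the main term: the sum of \<open>(i * s) ^ k\<close> over
  \<open>i < j < N\<close> turns \<open>n ^ k\<close> into \<open>n ^ (k + 2) / ((k + 1) * (k + 2))\<close>, exactly the factor that takes
  \<open>1 / fact k\<close> to \<open>1 / fact (k + 2)\<close>. The errors vanish when first \<open>N\<close> and then \<open>s\<close> is large.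
\<close>

lemma dec_number_step_bound:
  fixes C n :: real and k s N \<beta> :: nat
  assumes "C \<ge> 0" "N > 0" "s > 0" and n: "n = real N * real s"
    and pairs: "\<And>U W :: nat set. finite U \<Longrightarrow> finite W \<Longrightarrow> card U = s \<Longrightarrow> card W = s \<Longrightarrow> U \<inter> W = {} \<Longrightarrow>
      decomposable 4 (join (nsets U 2) (nsets W 2)) \<beta>"
    and \<beta>: "real \<beta> \<le> real s ^ 2 * (11 / 12 + 6 / s)"
    and hyp: "\<And>i. i < N \<Longrightarrow> real (dec_number (2 * k) (i * s)) \<le> C * real (i * s) ^ k"
  shows "real (dec_number (2 * k + 4) (N * s)) \<le>
    n ^ (k + 2) * (C / ((k + 1) * (k + 2)) * (11 / 12 + 6 / s) + 4 * (k + 2) * (1 / s + 1 / N))"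
proof -
  define e1 where "e1 = n ^ (k + 1) + n ^ (k + 2) / real N ^ 2"
  define e0 where "e0 = n ^ k + n ^ (k + 1) / real N ^ 2"
  define T where "T i = C * real (i * s) ^ k * real \<beta>" for i
  have s: "s > 0" "real s \<ge> 1" using assms(3) by simp_all
  have N: "real N \<ge> 1" using assms(2) by simp
  have n0: "n > 0" using s N n by simp
  have e: "e0 \<ge> 0" "e1 \<ge> 0" using n0 by (simp_all add: e0_def e1_def)
  have inner: "real (if b = 2 then dec_number (2 * k) (i * s) * \<beta> else dec_number (2 * k + 2 - b) (i * s) * s ^ (b div 2) * s)
      \<le> (if b = 2 then T i else e0 * s)" if "b \<in> {1..2 * k + 2}" "i < N" for i b
  proof (cases "b = 2")
    case True
    then show ?thesis using hyp[OF that(2)] by (simp add: T_def mult_right_mono del: of_nat_mult) (simp add: mult_right_mono)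
  next
    case False
    have "real (dec_number (2 * (k + 1) - b) (i * s) * s ^ (b div 2)) \<le> e0"
      unfolding e0_def using crude_term_le[OF that(2) _ False s(1) n, of "k + 1"] that(1) by simp
    then have "real (dec_number (2 * (k + 1) - b) (i * s) * s ^ (b div 2)) * real s \<le> e0 * s"
      by (intro mult_right_mono) auto
    then show ?thesis using False by simp
  qed
  have outer: "real (if a = 2 then x else dec_number (2 * k + 4 - a) (j * s) * s ^ (a div 2))
      \<le> (if a = 2 then real x else e1)" if "a \<in> {1..2 * k + 4}" "j < N" for a j x
  proof (cases "a = 2")
    case False
    have "2 * (k + 2) = 2 * k + 4" by simp
    moreover have "real (dec_number (2 * (k + 2) - a) (j * s) * s ^ (a div 2)) \<le> e1"
      unfolding e1_def using crude_term_le[OF that(2) _ False s(1) n, of "k + 2"] that(1) by simp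
    ultimately show ?thesis by (simp only: False if_False)
  qed simp
  have column: "real (\<Sum>b\<in>{1..2 * k + 2}. if b = 2 then dec_number (2 * k) (i * s) * \<beta>
      else dec_number (2 * k + 2 - b) (i * s) * s ^ (b div 2) * s) \<le> T i + 2 * (k + 1) * (e0 * s)"
    if "i < N" for i
  proof -
    have "real (\<Sum>b\<in>{1..2 * k + 2}. if b = 2 then dec_number (2 * k) (i * s) * \<beta>
      else dec_number (2 * k + 2 - b) (i * s) * s ^ (b div 2) * s)
      \<le> (\<Sum>b\<in>{1..2 * (k + 1)}. if b = 2 then T i else e0 * s)"
    proof -
      have "2 * (k + 1) = 2 * k + 2" by simp
      then show ?thesis unfolding of_nat_sum by (simp only:) (intro sum_mono inner that)
    qed
    also have "\<dots> \<le> T i + 2 * (k + 1) * (e0 * s)"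
      using sum_if_eq_2_le[of "e0 * s" "T i" "k + 1"] e by simp
    finally show ?thesis .
  qed
  have row: "real (\<Sum>a\<in>{1..2 * k + 4}. if a = 2
       then \<Sum>i<j. \<Sum>b\<in>{1..2 * k + 2}. if b = 2 then dec_number (2 * k) (i * s) * \<beta>
         else dec_number (2 * k + 2 - b) (i * s) * s ^ (b div 2) * s
       else dec_number (2 * k + 4 - a) (j * s) * s ^ (a div 2))
      \<le> (\<Sum>i<j. T i) + N * (2 * (k + 1) * (e0 * s)) + 2 * (k + 2) * e1" (is "real (\<Sum>a\<in>_. if a = 2 then ?x else _ a) \<le> _")
    if "j < N" for j
  proof -
    have "real (\<Sum>a\<in>{1..2 * k + 4}. if a = 2 then ?x else dec_number (2 * k + 4 - a) (j * s) * s ^ (a div 2))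
      \<le> (\<Sum>a\<in>{1..2 * (k + 2)}. if a = 2 then real ?x else e1)"
    proof -
      have "2 * (k + 2) = 2 * k + 4" by simp
      then show ?thesis
        unfolding of_nat_sum[of _ "{1..2 * k + 4}"] by (simp only:) (intro sum_mono outer that)
    qed
    also have "\<dots> \<le> real ?x + 2 * (k + 2) * e1"
      using sum_if_eq_2_le[of e1 "real ?x" "k + 2"] e by simp
    also have "real ?x \<le> (\<Sum>i<j. T i + 2 * (k + 1) * (e0 * s))"
      unfolding of_nat_sum[of _ "{..<j}"] using column that by (intro sum_mono) auto
    also have "\<dots> = (\<Sum>i<j. T i) + j * (2 * (k + 1) * (e0 * s))" by (simp add: sum.distrib)
    also have "\<dots> \<le> (\<Sum>i<j. T i) + N * (2 * (k + 1) * (e0 * s))"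
      using that e by (intro add_left_mono mult_right_mono) auto
    finally show ?thesis by simp
  qed
  have "real (dec_number (2 * k + 4) (N * s)) \<le>
      real (\<Sum>j<N. \<Sum>a\<in>{1..2 * k + 4}. if a = 2
       then \<Sum>i<j. \<Sum>b\<in>{1..2 * k + 2}. if b = 2 then dec_number (2 * k) (i * s) * \<beta>
         else dec_number (2 * k + 2 - b) (i * s) * s ^ (b div 2) * s
       else dec_number (2 * k + 4 - a) (j * s) * s ^ (a div 2))"
    unfolding of_nat_le_iff by (rule dec_number_intervals[OF pairs])
  also have "\<dots> \<le> (\<Sum>j<N. (\<Sum>i<j. T i) + N * (2 * (k + 1) * (e0 * s)) + 2 * (k + 2) * e1)"
    unfolding of_nat_sum[of _ "{..<N}"] by (intro sum_mono row) auto
  also have "\<dots> = (\<Sum>j<N. \<Sum>i<j. T i) + N * (N * (2 * (k + 1) * (e0 * s)) + 2 * (k + 2) * e1)"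
    by (simp add: sum.distrib algebra_simps)
  also have "N * (N * (2 * (k + 1) * (e0 * s)) + 2 * (k + 2) * e1) = (4 * k + 6) * (N * e1)"
  proof -
    have "N * (e0 * s) = e1" by (simp add: e0_def e1_def n field_simps)
    then have "N * (2 * (k + 1) * (e0 * s)) = 2 * (k + 1) * e1" by (simp add: mult.left_commute)
    then show ?thesis by (simp add: algebra_simps)
  qed
  also have "\<dots> \<le> 4 * (k + 2) * (N * e1)" using e by (intro mult_right_mono) auto
  also have "N * e1 = n ^ (k + 2) * (1 / s + 1 / N)"
    using N s by (simp add: e1_def n field_simps power2_eq_square)
  also have "(\<Sum>j<N. \<Sum>i<j. T i) = C * s ^ k * \<beta> * (\<Sum>j<N. \<Sum>i<j. real i ^ k)"
    by (simp add: T_def sum_distrib_left power_mult_distrib mult_ac)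
  also have "\<dots> \<le> C * s ^ k * \<beta> * (real N ^ (k + 2) / ((k + 1) * (k + 2)))"
    using assms(1) by (intro mult_left_mono sum_sum_power_le) auto
  also have "\<dots> \<le> C * s ^ k * (real s ^ 2 * (11 / 12 + 6 / s)) * (real N ^ (k + 2) / ((k + 1) * (k + 2)))"
    using assms(1) \<beta> by (intro mult_right_mono mult_left_mono) auto
  also have "\<dots> = n ^ (k + 2) * (C / ((k + 1) * (k + 2)) * (11 / 12 + 6 / s))"
    by (simp add: n power_mult_distrib power_add power2_eq_square mult_ac)
  finally show ?thesis by (simp add: algebra_simps)
qed

text \<open>
  A bound along the multiples of \<open>M\<close> extends to all \<open>n\<close> by rounding up to the next multiple; this
  changes \<open>n ^ K\<close> by a factor that tends to 1.
\<close>

lemma eventually_shifted_power_le: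
  fixes A B :: real
  assumes "A < B"
  shows "eventually (\<lambda>n. A * (real n + real M) ^ K \<le> B * real n ^ K) sequentially"
proof -
  have "(\<lambda>n. A * (1 + real M / real n) ^ K) \<longlonglongrightarrow> A * (1 + 0) ^ K"
    by (intro tendsto_mult tendsto_power tendsto_add tendsto_const lim_const_over_n)
  then have "(\<lambda>n. A * (1 + real M / real n) ^ K) \<longlonglongrightarrow> A" by simp
  then have "eventually (\<lambda>n. A * (1 + real M / real n) ^ K < B) sequentially"
    using assms by (rule order_tendstoD(2))
  then obtain n1 where n1: "\<And>n. n \<ge> n1 \<Longrightarrow> A * (1 + real M / real n) ^ K < B"
    unfolding eventually_sequentially by blast
  have "A * (real n + real M) ^ K \<le> B * real n ^ K" if "n \<ge> Suc n1" for n
  proof -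
    have n: "real n > 0" "n \<ge> n1" using that by simp_all
    then have "real n + real M = (1 + real M / real n) * real n" by (simp add: distrib_right)
    then have "A * (real n + real M) ^ K = A * (1 + real M / real n) ^ K * real n ^ K"
      by (simp only: power_mult_distrib mult.assoc)
    also have "\<dots> \<le> B * real n ^ K"
      by (intro mult_right_mono less_imp_le[OF n1[OF n(2)]]) simp
    finally show ?thesis .
  qed
  then show ?thesis unfolding eventually_sequentially by blast
qed

lemma multiple_above:
  fixes M m0 n :: nat
  assumes "M > 0" "m0 \<le> n div M"
  obtains m where "m0 \<le> m" "n \<le> M * m" "M * m \<le> n + M"
proof
  show "m0 \<le> Suc (n div M)" by (rule le_SucI[OF assms(2)])
  show "n \<le> M * Suc (n div M)"
    unfolding mult_Suc_right by (rule less_imp_le[OF dividend_less_times_div[OF assms(1)]])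
  show "M * Suc (n div M) \<le> n + M"
    unfolding mult_Suc_right add.commute[of M] by (rule add_right_mono[OF times_div_less_eq_dividend])
qed

lemma eventually_le_from_multiples:
  fixes f :: "nat \<Rightarrow> real" and M K :: nat
  assumes mono: "\<And>m n. m \<le> n \<Longrightarrow> f m \<le> f n" and M: "M > 0" and "0 \<le> A" "A < B"
    and multiples: "\<And>m. m \<ge> m0 \<Longrightarrow> f (M * m) \<le> A * real (M * m) ^ K"
  shows "eventually (\<lambda>n. f n \<le> B * real n ^ K) sequentially"
proof -
  have *: "f n \<le> A * (real n + real M) ^ K" if n: "M * m0 \<le> n" for n
  proof -
    have "m0 \<le> n div M" using div_le_mono[OF n, of M] M by simp
    from multiple_above[OF M this] obtain m where m: "m0 \<le> m" "n \<le> M * m" "M * m \<le> n + M" .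
    have le: "real (M * m) \<le> real n + real M"
      unfolding of_nat_add[symmetric] of_nat_le_iff by (rule m(3))
    have "f n \<le> f (M * m)" by (rule mono[OF m(2)])
    also have "\<dots> \<le> A * real (M * m) ^ K" by (rule multiples[OF m(1)])
    also have "\<dots> \<le> A * (real n + real M) ^ K"
      by (rule mult_left_mono[OF power_mono[OF le of_nat_0_le_iff] assms(3)])
    finally show ?thesis .
  qed
  show ?thesis
    by (rule eventually_mp[OF _ eventually_conj[OF eventually_ge_at_top[of "M * m0"]
            eventually_shifted_power_le[OF assms(4), of M K]]])
       (rule always_eventually, use * order_trans in blast)
qed

text \<open>
  Any factor larger than \<open>11 / 12\<close> could take the place of \<open>14 / 15\<close>. With \<open>11 / 12 = 220 / 240\<close> and
  \<open>14 / 15 = 224 / 240\<close>, the errors from \<open>N\<close> and from \<open>s\<close> are kept below \<open>1 / 160\<close> each, which leads to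
  \<open>223 / 240\<close> along multiples of \<open>12 * N\<close>; the last \<open>1 / 240\<close> is used to reach all \<open>n\<close>. The value at
  \<open>0\<close> is needed because the edges below the first interval are edges on no vertices.
\<close>

lemma dec_number_step:
  fixes C :: real
  assumes "C > 0" and ev: "eventually (\<lambda>n. real (dec_number (2 * k) n) \<le> C * real n ^ k) sequentially"
    and zero: "real (dec_number (2 * k) 0) \<le> C * 0 ^ k"
    and pairs: "\<And>m (U :: nat set) W. finite U \<Longrightarrow> finite W \<Longrightarrow> card U = 12 * m \<Longrightarrow> card W = 12 * m \<Longrightarrow> U \<inter> W = {} \<Longrightarrow>
      decomposable 4 (join (nsets U 2) (nsets W 2)) (132 * m\<^sup>2 + 37 * m + 2)"
  shows "eventually (\<lambda>n. real (dec_number (2 * k + 4) n) \<le>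
    14 / 15 * C / ((k + 1) * (k + 2)) * real n ^ (k + 2)) sequentially"
proof -
  define D where "D = C / ((k + 1) * (k + 2))"
  have D: "D > 0"
    unfolding D_def using assms(1) by (intro divide_pos_pos) (auto intro!: add_pos_nonneg)
  obtain N :: nat where N: "640 * (k + 2) / D < N" using reals_Archimedean2 by blast
  have "640 * (k + 2) / D > 0" using D by simp
  with N have N0: "N > 0" by (metis of_nat_0_less_iff order_less_trans)
  have NN: "4 * (k + 2) * (1 / N) \<le> D / 160" using N D N0 by (simp add: field_simps)
  from ev obtain n0 where n0: "\<And>n. n \<ge> n0 \<Longrightarrow> real (dec_number (2 * k) n) \<le> C * real n ^ k"
    by (auto simp: eventually_sequentially)
  obtain m1 :: nat where m1: "160 * (6 * D + 4 * (k + 2)) / D < m1" using reals_Archimedean2 by blast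
  have multiples: "real (dec_number (2 * k + 4) (12 * N * m)) \<le> 223 / 240 * D * real (12 * N * m) ^ (k + 2)"
    if "m \<ge> Suc (max m1 n0)" for m
  proof -
    from that have m: "m > 0" "m \<ge> m1" "m \<ge> n0" by auto
    define s where "s = 12 * m"
    have "real (dec_number (2 * k) (i * s)) \<le> C * real (i * s) ^ k" for i
    proof (cases "i = 0")
      case True
      then show ?thesis using zero by simp
    next
      case False
      then have "n0 \<le> i * s" using m(3) by (cases i) (auto simp: s_def)
      then show ?thesis by (rule n0)
    qed
    then have "real (dec_number (2 * k + 4) (N * s)) \<le> (real N * real s) ^ (k + 2) *
        (D * (11 / 12 + 6 / s) + 4 * (k + 2) * (1 / s + 1 / N))"
      unfolding D_def
    proof (intro dec_number_step_bound)
      show "decomposable 4 (join (nsets U 2) (nsets W 2)) (132 * m\<^sup>2 + 37 * m + 2)"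
        if "finite U" "finite W" "card U = s" "card W = s" "U \<inter> W = {}" for U W :: "nat set"
        using that unfolding s_def by (rule pairs)
      show "real (132 * m\<^sup>2 + 37 * m + 2) \<le> real s ^ 2 * (11 / 12 + 6 / s)"
        using m(1) by (simp add: s_def field_simps power2_eq_square)
    qed (use assms(1) N0 m(1) in \<open>auto simp: s_def\<close>)
    also have "\<dots> \<le> (real N * real s) ^ (k + 2) * (223 / 240 * D)"
    proof (intro mult_left_mono)
      have "160 * (6 * D + 4 * (k + 2)) / D \<le> s" using m1 m(2) by (simp add: s_def)
      then have "6 * D / s + 4 * (k + 2) / s \<le> D / 160"
        using D m(1) by (simp add: s_def field_simps)
      moreover have "D * (11 / 12 + 6 / s) + 4 * (k + 2) * (1 / s + 1 / N) =
          220 / 240 * D + (6 * D / s + 4 * (k + 2) / s) + 4 * (k + 2) * (1 / N)"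
        by (simp add: algebra_simps add_divide_distrib)
      ultimately show "D * (11 / 12 + 6 / s) + 4 * (k + 2) * (1 / s + 1 / N) \<le> 223 / 240 * D"
        using NN by linarith
    qed simp
    finally show ?thesis by (simp add: s_def mult_ac)
  qed
  have "eventually (\<lambda>n. real (dec_number (2 * k + 4) n) \<le> 14 / 15 * D * real n ^ (k + 2)) sequentially"
    using D N0 dec_number_mono
    by (intro eventually_le_from_multiples[of _ "12 * N" "223 / 240 * D", OF _ _ _ _ multiples]) simp_all
  then show ?thesis by (simp add: D_def)
qed

section \<open>The asymptotic bound, given a bound for pairs of edges\<close>

text \<open>
  Each step raises \<open>k\<close> by 2 and brings one factor \<open>14 / 15\<close>. The assumption \<open>pairs\<close>, here and in
  the next lemma, is the conclusion of \<open>decomposable_join_nsets_2\<close>.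
\<close>

lemma dec_number_asymptotic:
  assumes pairs: "\<And>m (U :: nat set) W. finite U \<Longrightarrow> finite W \<Longrightarrow> card U = 12 * m \<Longrightarrow> card W = 12 * m \<Longrightarrow> U \<inter> W = {} \<Longrightarrow>
      decomposable 4 (join (nsets U 2) (nsets W 2)) (132 * m\<^sup>2 + 37 * m + 2)"
  shows "eventually (\<lambda>n. real (dec_number (2 * k) n) \<le> (14 / 15) ^ (k div 2) / fact k * real n ^ k) sequentially"
proof (induction k rule: induct_nat_012)
  case (ge2 k)
  have "dec_number (2 * k) 0 \<le> 0 ^ k" using dec_number_le_power[of "2 * k" 0] by simp
  then have "real (dec_number (2 * k) 0) \<le> (14 / 15) ^ (k div 2) / fact k * 0 ^ k"
    by (cases "k = 0") (auto simp: power_0_left)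
  then have "eventually (\<lambda>n. real (dec_number (2 * k + 4) n) \<le>
    14 / 15 * ((14 / 15) ^ (k div 2) / fact k) / ((k + 1) * (k + 2)) * real n ^ (k + 2)) sequentially"
    by (intro dec_number_step[OF _ ge2(1) _ pairs]) simp_all
  moreover have "14 / 15 * ((14 / 15) ^ (k div 2) / fact k) / ((k + 1) * (k + 2)) =
      ((14 / 15) ^ (Suc (Suc k) div 2) / fact (Suc (Suc k)) :: real)"
    by (simp add: field_simps)
  moreover have "2 * Suc (Suc k) = 2 * k + 4" "k + 2 = Suc (Suc k)" by simp_all
  ultimately show ?case by (simp only:)
qed (use dec_number_le_power[of 0] dec_number_le_power[of 2] in
      \<open>auto simp: numeral_2_eq_2 simp flip: of_nat_power\<close>)

lemma block_number_bound:
  fixes r :: nat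
  assumes "even r" and "r \<ge> 6" and pairs: "\<And>m (U :: nat set) W. finite U \<Longrightarrow> finite W \<Longrightarrow> card U = 12 * m \<Longrightarrow> card W = 12 * m \<Longrightarrow> U \<inter> W = {} \<Longrightarrow>
      decomposable 4 (join (nsets U 2) (nsets W 2)) (132 * m\<^sup>2 + 37 * m + 2)"
  shows "\<exists>\<epsilon> :: nat \<Rightarrow> real. \<epsilon> \<in> o(\<lambda>n. 1) \<and>
    (\<forall>n>0. real (block_number r n) \<le> (14 / 15) powr (real r / 6) * (1 + \<epsilon> n) * real (n choose (r div 2)))"
proof -
  define k where "k = r div 2"
  have r: "r = 2 * k" "k \<ge> 3" using assms by (auto simp: k_def)
  \<comment> \<open>An edge consists of \<open>k\<close> pairs, and every two pairs give a factor \<open>14 / 15\<close>.\<close>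
  have "real r / 6 \<le> real (k div 2)"
  proof -
    have "k \<le> 3 * (k div 2)" using r(2) by presburger
    then have "real k \<le> 3 * real (k div 2)" by (metis of_nat_le_iff of_nat_mult of_nat_numeral)
    then show ?thesis using r(1) by simp
  qed
  then have "(14 / 15 :: real) powr real (k div 2) \<le> (14 / 15) powr (real r / 6)"
    by (intro powr_mono') auto
  then have exponent: "(14 / 15 :: real) ^ (k div 2) \<le> (14 / 15) powr (real r / 6)"
    by (simp add: powr_realpow)
  have "eventually (\<lambda>n. real (block_number r n) \<le> (14 / 15) ^ (k div 2) / fact k * real n ^ k) sequentially"
    using dec_number_asymptotic[OF pairs, of k]
  proof (rule eventually_mono)
    fix n assume "real (dec_number (2 * k) n) \<le> (14 / 15) ^ (k div 2) / fact k * real n ^ k"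
    then show "real (block_number r n) \<le> (14 / 15) ^ (k div 2) / fact k * real n ^ k"
      unfolding r(1) by (rule order_trans[rotated]) (simp add: block_number_le_dec_number)
  qed
  moreover have "real (block_number r n) \<le> 0" if "n < k" for n
    using that r by (simp add: block_number_eq_0)
  ultimately have "\<exists>\<epsilon>. \<epsilon> \<in> o(\<lambda>n. 1) \<and>
      (\<forall>n. real (block_number r n) \<le> (14 / 15) powr (real r / 6) * (1 + \<epsilon> n) * real (n choose k))"
    using exponent by (intro power_bound_imp_binomial_bound) auto
  then show ?thesis unfolding k_def by blast
qed

section \<open>Classes of edges in a grid of vertices\<close>

text \<open>
  Let the vertices be pairs \<open>(i, a)\<close> of a group \<open>i\<close> and an index \<open>a < m\<close>. The kind of an edge records
  its two groups, in increasing order, and whether its two indices agree. A kind \<open>(i, i, False)\<close> is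
  the complete graph on a group; for \<open>i < j\<close> the kind \<open>(i, j, True)\<close> is a perfect matching between
  two groups and \<open>(i, j, False)\<close> is the complement of this matching in the complete bipartite graph.
\<close>

definition kind :: "(nat \<times> nat) set \<Rightarrow> nat \<times> nat \<times> bool" where
  "kind e = (Min (fst ` e), Max (fst ` e), card (snd ` e) = 1)"

definition pairs_of_kind :: "nat set \<Rightarrow> nat \<Rightarrow> (nat \<times> nat \<times> bool) set \<Rightarrow> (nat \<times> nat) set set" where
  "pairs_of_kind I m C = {e \<in> nsets (I \<times> {..<m}) 2. kind e \<in> C}"

lemma kind_pair: "kind {(i, a), (j, b)} = (min i j, max i j, a = b)"
  by (auto simp: kind_def card_insert_if)

lemma nsets_pair: "{x, y} \<in> nsets V 2 \<longleftrightarrow> x \<in> V \<and> y \<in> V \<and> x \<noteq> y"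
  by (auto simp: nsets_def card_insert_if)

lemma min_max_eq_iff:
  "min i j = min k l \<and> max i j = max k (l::nat) \<longleftrightarrow> i = k \<and> j = l \<or> i = l \<and> j = k"
  by (auto simp: min_def max_def)

lemma pairs_of_kind_Un: "pairs_of_kind I m (C \<union> C') = pairs_of_kind I m C \<union> pairs_of_kind I m C'"
  by (auto simp: pairs_of_kind_def)

lemma pairs_of_kind_disjoint: "C \<inter> C' = {} \<Longrightarrow> pairs_of_kind I m C \<inter> pairs_of_kind I m C' = {}"
  by (auto simp: pairs_of_kind_def)

lemma Union_pairs_of_kind: "\<Union> (pairs_of_kind I m C) \<subseteq> I \<times> {..<m}"
  by (auto simp: pairs_of_kind_def nsets_def)

lemma decomposable_kinds_Un:
  assumes "decomposable 2 (pairs_of_kind I m C) x" "decomposable 2 (pairs_of_kind I m C') y" "C \<inter> C' = {}"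
  shows "decomposable 2 (pairs_of_kind I m (C \<union> C')) (x + y)"
  unfolding pairs_of_kind_Un
  by (rule decomposable_Un[OF assms(1,2) pairs_of_kind_disjoint[OF assms(3)]])

lemma pairs_of_kind_cases:
  assumes "e \<in> pairs_of_kind I m C"
  obtains i a j b where "e = {(i, a), (j, b)}" "(i, a) \<noteq> (j, b)" "i \<in> I" "j \<in> I" "a < m" "b < m"
    "(min i j, max i j, a = b) \<in> C"
proof -
  from assms have e: "e \<in> nsets (I \<times> {..<m}) 2" "kind e \<in> C" by (auto simp: pairs_of_kind_def)
  then obtain x y where xy: "e = {x, y}" "x \<noteq> y" by (auto simp: nsets_def card_2_iff)
  then show thesis
    using e that[of "fst x" "snd x" "fst y" "snd y"] by (cases x; cases y) (auto simp: nsets_pair kind_pair)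
qed

text \<open>
  For each index \<open>a\<close>, join all vertices of index \<open>a\<close> in the groups \<open>S\<close> to the vertices in the groups
  \<open>T\<close> with an index different from \<open>a\<close> and to those in the groups \<open>T'\<close> with index \<open>a\<close>; if
  \<open>R = S\<close>, also to the vertices in the groups \<open>S\<close> with a larger index. These are the kinds of edges
  obtained.
\<close>

definition star_kinds :: "nat set \<Rightarrow> nat set \<Rightarrow> nat set \<Rightarrow> nat set \<Rightarrow> (nat \<times> nat \<times> bool) set" where
  "star_kinds R S T T' = (\<Union>i\<in>R. \<Union>j\<in>R. {(min i j, max i j, False)}) \<union>
     (\<Union>i\<in>S. \<Union>j\<in>T. {(min i j, max i j, False)}) \<union> (\<Union>i\<in>S. \<Union>j\<in>T'. {(min i j, max i j, True)})"

lemma mem_star_kinds: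
  "(min i j, max i j, t) \<in> star_kinds R S T T' \<longleftrightarrow>
    \<not> t \<and> i \<in> R \<and> j \<in> R \<or>
    (i \<in> S \<and> (if t then j \<in> T' else j \<in> T)) \<or> (j \<in> S \<and> (if t then i \<in> T' else i \<in> T))"
proof -
  have "(min i j, max i j, t) \<in> star_kinds R S T T' \<longleftrightarrow>
    (\<exists>k l. (min i j = min k l \<and> max i j = max k l) \<and>
      (k \<in> R \<and> l \<in> R \<and> \<not> t \<or> k \<in> S \<and> l \<in> T \<and> \<not> t \<or> k \<in> S \<and> l \<in> T' \<and> t))"
    unfolding star_kinds_def Un_iff UN_iff singleton_iff prod.inject Bex_def by (cases t) blast+
  then show ?thesis unfolding min_max_eq_iff by (cases t) auto
qed

text \<open>
  There is one complete bipartite graph for each index, whatever the number of groups involved. This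
  is the source of all savings: several of the kinds in a star would need \<open>m\<close> bipartite graphs each
  if they were decomposed separately.
\<close>

lemma decomposable_star:
  assumes "R = {} \<or> R = S" "S \<inter> T = {}" "S \<inter> T' = {}" "S \<subseteq> I" "T \<subseteq> I" "T' \<subseteq> I"
  shows "decomposable 2 (pairs_of_kind I m (star_kinds R S T T')) m"
proof -
  define L where "L a = (T \<times> ({..<m} - {a}) \<union> T' \<times> {a} \<union> R \<times> {a<..<m})" for a
  define E where "E a = block_edges [S \<times> {a}, L a]" for a
  have E: "e \<in> E a \<longleftrightarrow> (\<exists>x y. e = {x, y} \<and> x \<in> S \<times> {a} \<and> y \<in> L a)" for e and a :: nat
    unfolding E_def block_edges_pair by (rule mem_Collect_eq)
  have eq: "pairs_of_kind I m (star_kinds R S T T') = (\<Union>a<m. E a)"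
  proof (intro equalityI subsetI)
    fix e assume "e \<in> pairs_of_kind I m (star_kinds R S T T')"
    then obtain i a j b where e: "e = {(i, a), (j, b)}" "(i, a) \<noteq> (j, b)" "a < m" "b < m"
      and k: "(min i j, max i j, a = b) \<in> star_kinds R S T T'"
      by (elim pairs_of_kind_cases)
    \<comment> \<open>Edges inside \<open>S\<close> belong to the star of their smaller index, all others to that of their end in \<open>S\<close>.\<close>
    have k': "i \<in> S \<and> (j, b) \<in> L a \<or> j \<in> S \<and> (i, a) \<in> L b"
      using k assms(1) e(3,4) unfolding mem_star_kinds
      by (cases a b rule: linorder_cases) (auto simp: L_def)
    have "e \<in> E a \<or> e \<in> E b"
      using k'
    proof
      assume "i \<in> S \<and> (j, b) \<in> L a"
      then have "e \<in> E a" unfolding E e(1) by (intro exI[of _ "(i, a)"] exI[of _ "(j, b)"]) simp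
      then show ?thesis ..
    next
      assume "j \<in> S \<and> (i, a) \<in> L b"
      then have "e \<in> E b"
        unfolding E e(1) by (intro exI[of _ "(j, b)"] exI[of _ "(i, a)"]) (simp add: insert_commute)
      then show ?thesis ..
    qed
    then show "e \<in> (\<Union>a<m. E a)" using e(3,4) by blast
  next
    fix e assume "e \<in> (\<Union>a<m. E a)"
    then obtain a where a: "a < m" "e \<in> E a" by blast
    then obtain x y where "e = {x, y}" "x \<in> S \<times> {a}" "y \<in> L a" unfolding E by metis
    then obtain i j b where "e = {(i, a), (j, b)}" "i \<in> S" "(j, b) \<in> L a"
      by (cases x, cases y) simp
    then show "e \<in> pairs_of_kind I m (star_kinds R S T T')"
      using assms a(1) unfolding pairs_of_kind_def
      by (auto simp: nsets_pair kind_pair mem_star_kinds L_def)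
  qed
  have "disjoint_family_on E {..<m}"
    unfolding disjoint_family_on_def
  proof (intro ballI impI)
    fix a a' :: nat assume "a \<noteq> a'"
    have False if "e \<in> E a" "e \<in> E a'" for e
    proof -
      from that obtain x y x' y' where
        e: "{x, y} = {x', y'}" "x \<in> S \<times> {a}" "y \<in> L a" "x' \<in> S \<times> {a'}" "y' \<in> L a'"
        unfolding E by metis
      moreover from this \<open>a \<noteq> a'\<close> have "x \<noteq> x'" by auto
      ultimately have "y' = x" "y = x'" by (metis doubleton_eq_iff)+
      then show False using e(2-5) assms(2,3) by (auto simp: L_def)
    qed
    then show "E a \<inter> E a' = {}" by blast
  qed
  moreover have "decomposable 2 (E a) 1" for a
    unfolding E_def using assms(1-3)
    by (intro decomposable_block) (auto simp: disjnt_def L_def)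
  ultimately have "decomposable 2 (\<Union>a<m. E a) (\<Sum>a<m. 1)"
    by (intro decomposable_UN) auto
  then show ?thesis by (simp add: eq)
qed

text \<open>
  Between two sets of groups, the matchings and their complements together cost a single bipartite
  graph. Relative to \<open>m\<close> such a union is free, although each of the two halves costs \<open>m\<close>.
\<close>

lemma decomposable_bipartite:
  assumes "S \<inter> T = {}" "S \<subseteq> I" "T \<subseteq> I"
  shows "decomposable 2 (pairs_of_kind I m (star_kinds {} S T T)) 1"
proof -
  have "pairs_of_kind I m (star_kinds {} S T T) = block_edges [S \<times> {..<m}, T \<times> {..<m}]"
  proof (intro equalityI subsetI)
    fix e assume "e \<in> pairs_of_kind I m (star_kinds {} S T T)"
    then obtain i a j b where e: "e = {(i, a), (j, b)}" "a < m" "b < m"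
      and k: "(min i j, max i j, a = b) \<in> star_kinds {} S T T"
      by (elim pairs_of_kind_cases)
    have "i \<in> S \<and> j \<in> T \<or> j \<in> S \<and> i \<in> T"
      using k unfolding mem_star_kinds by (auto split: if_splits)
    then have "(i, a) \<in> S \<times> {..<m} \<and> (j, b) \<in> T \<times> {..<m} \<or> (j, b) \<in> S \<times> {..<m} \<and> (i, a) \<in> T \<times> {..<m}"
      using e by auto
    then show "e \<in> block_edges [S \<times> {..<m}, T \<times> {..<m}]"
      unfolding e(1) block_edges_pair mem_Collect_eq
    proof
      assume "(i, a) \<in> S \<times> {..<m} \<and> (j, b) \<in> T \<times> {..<m}"
      then show "\<exists>x y. {(i, a), (j, b)} = {x, y} \<and> x \<in> S \<times> {..<m} \<and> y \<in> T \<times> {..<m}"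
        by (intro exI[of _ "(i, a)"] exI[of _ "(j, b)"]) simp
    next
      assume "(j, b) \<in> S \<times> {..<m} \<and> (i, a) \<in> T \<times> {..<m}"
      then show "\<exists>x y. {(i, a), (j, b)} = {x, y} \<and> x \<in> S \<times> {..<m} \<and> y \<in> T \<times> {..<m}"
        by (intro exI[of _ "(j, b)"] exI[of _ "(i, a)"]) (simp add: insert_commute)
    qed
  next
    fix e assume "e \<in> block_edges [S \<times> {..<m}, T \<times> {..<m}]"
    then obtain x y where "e = {x, y}" "x \<in> S \<times> {..<m}" "y \<in> T \<times> {..<m}"
      unfolding block_edges_pair mem_Collect_eq by metis
    moreover obtain i a j b where "x = (i, a)" "y = (j, b)" by (cases x, cases y) blast
    ultimately have "a < m" "b < m" "e = {(i, a), (j, b)}" "i \<in> S" "j \<in> T" by simp_all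
    then show "e \<in> pairs_of_kind I m (star_kinds {} S T T)"
      using assms unfolding pairs_of_kind_def
      by (auto simp: nsets_pair kind_pair mem_star_kinds)
  qed
  moreover have "decomposable 2 (block_edges [S \<times> {..<m}, T \<times> {..<m}]) 1"
    using assms by (intro decomposable_block) (auto simp: disjnt_def)
  ultimately show ?thesis by simp
qed

section \<open>A tiling for pairs of edges\<close>

text \<open>
  A tiling of \<open>{A, G, G'} \<times> {N, H, H', P}\<close> by six rectangles. In terms of columns, the left factor is
  split as \<open>A \<union> G, G'\<close> over \<open>N\<close>, as \<open>A \<union> G', G\<close> over \<open>H\<close>, as \<open>A, G \<union> G'\<close> over \<open>P\<close>, and into
  all three pieces over \<open>H'\<close>. Over \<open>H'\<close> this is wasteful, but each of the three pieces is merged with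
  the rectangle of the same piece over \<open>N\<close>, \<open>H\<close> or \<open>P\<close>. The tiling wins if adding \<open>H'\<close> to these
  sets makes them no more expensive, or even cheaper.
\<close>

lemma decomposable_tiling:
  assumes left: "decomposable r (A \<union> G) x1" "decomposable r G' x2" "decomposable r (A \<union> G') x3"
      "decomposable r G x4" "decomposable r A x5" "decomposable r (G \<union> G') x6"
    and right: "decomposable s N y1" "decomposable s (N \<union> H') y2" "decomposable s H y3"
      "decomposable s (H \<union> H') y4" "decomposable s (P \<union> H') y5" "decomposable s P y6"
    and disj: "A \<inter> G = {}" "A \<inter> G' = {}" "G \<inter> G' = {}"
      "N \<inter> H = {}" "N \<inter> H' = {}" "N \<inter> P = {}" "H \<inter> H' = {}" "H \<inter> P = {}" "H' \<inter> P = {}"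
    and support: "\<Union> (A \<union> G \<union> G') \<inter> \<Union> (N \<union> H \<union> H' \<union> P) = {}"
  shows "decomposable (r + s) (join (A \<union> G \<union> G') (N \<union> H \<union> H' \<union> P))
    (x1 * y1 + x2 * y2 + x3 * y3 + x4 * y4 + x5 * y5 + x6 * y6)"
proof -
  have dec: "decomposable (r + s) (join F K) (x * y)"
    if "decomposable r F x" "decomposable s K y" "F \<subseteq> A \<union> G \<union> G'" "K \<subseteq> N \<union> H \<union> H' \<union> P" for F K x y
    using that support by (intro decomposable_join) blast+
  have dj: "join F K \<inter> join F' K' = {}"
    if "F \<inter> F' = {} \<or> K \<inter> K' = {}" "F \<union> F' \<subseteq> A \<union> G \<union> G'" "K \<union> K' \<subseteq> N \<union> H \<union> H' \<union> P" for F F' K K'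
    using that(2,3) by (intro join_disjoint[OF that(1) _ _ _ _ support]) blast+
  let ?R1 = "join (A \<union> G) N" and ?R2 = "join G' (N \<union> H')" and ?R3 = "join (A \<union> G') H"
    and ?R4 = "join G (H \<union> H')" and ?R5 = "join A (P \<union> H')" and ?R6 = "join (G \<union> G') P"
  have "decomposable (r + s) ?R1 (x1 * y1)" by (rule dec[OF left(1) right(1)]) auto
  moreover have "decomposable (r + s) ?R2 (x2 * y2)" by (rule dec[OF left(2) right(2)]) auto
  moreover have "?R1 \<inter> ?R2 = {}" by (rule dj) (use disj in auto)
  ultimately have "decomposable (r + s) (?R1 \<union> ?R2) (x1 * y1 + x2 * y2)" by (rule decomposable_Un)
  moreover have "decomposable (r + s) ?R3 (x3 * y3)" by (rule dec[OF left(3) right(3)]) auto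
  moreover have "(?R1 \<union> ?R2) \<inter> ?R3 = {}"
    unfolding Int_Un_distrib2 Un_empty by (intro conjI dj) (use disj in auto)
  ultimately have "decomposable (r + s) (?R1 \<union> ?R2 \<union> ?R3) (x1 * y1 + x2 * y2 + x3 * y3)"
    by (rule decomposable_Un)
  moreover have "decomposable (r + s) ?R4 (x4 * y4)" by (rule dec[OF left(4) right(4)]) auto
  moreover have "(?R1 \<union> ?R2 \<union> ?R3) \<inter> ?R4 = {}"
    unfolding Int_Un_distrib2 Un_empty by (intro conjI dj) (use disj in auto)
  ultimately have "decomposable (r + s) (?R1 \<union> ?R2 \<union> ?R3 \<union> ?R4) (x1 * y1 + x2 * y2 + x3 * y3 + x4 * y4)"
    by (rule decomposable_Un)
  moreover have "decomposable (r + s) ?R5 (x5 * y5)" by (rule dec[OF left(5) right(5)]) auto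
  moreover have "(?R1 \<union> ?R2 \<union> ?R3 \<union> ?R4) \<inter> ?R5 = {}"
    unfolding Int_Un_distrib2 Un_empty by (intro conjI dj) (use disj in auto)
  ultimately have "decomposable (r + s) (?R1 \<union> ?R2 \<union> ?R3 \<union> ?R4 \<union> ?R5)
      (x1 * y1 + x2 * y2 + x3 * y3 + x4 * y4 + x5 * y5)"
    by (rule decomposable_Un)
  moreover have "decomposable (r + s) ?R6 (x6 * y6)" by (rule dec[OF left(6) right(6)]) auto
  moreover have "(?R1 \<union> ?R2 \<union> ?R3 \<union> ?R4 \<union> ?R5) \<inter> ?R6 = {}"
    unfolding Int_Un_distrib2 Un_empty by (intro conjI dj) (use disj in auto)
  ultimately have "decomposable (r + s) (?R1 \<union> ?R2 \<union> ?R3 \<union> ?R4 \<union> ?R5 \<union> ?R6)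
      (x1 * y1 + x2 * y2 + x3 * y3 + x4 * y4 + x5 * y5 + x6 * y6)"
    by (rule decomposable_Un)
  moreover have "join (A \<union> G \<union> G') (N \<union> H \<union> H' \<union> P) = ?R1 \<union> ?R2 \<union> ?R3 \<union> ?R4 \<union> ?R5 \<union> ?R6"
    unfolding join_Un_left join_Un_right by blast
  ultimately show ?thesis by simp
qed

lemma nsets_eq_pairs_of_kind:
  assumes "\<And>i j. i \<in> I \<Longrightarrow> j \<in> I \<Longrightarrow> i \<le> j \<Longrightarrow> (i, j, False) \<in> C"
    and "\<And>i j. i \<in> I \<Longrightarrow> j \<in> I \<Longrightarrow> i < j \<Longrightarrow> (i, j, True) \<in> C"
  shows "nsets (I \<times> {..<m}) 2 = pairs_of_kind I m C"
proof -
  have "e \<in> pairs_of_kind I m C" if "e \<in> nsets (I \<times> {..<m}) 2" for e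
  proof -
    have "e \<in> pairs_of_kind I m UNIV" using that by (simp add: pairs_of_kind_def)
    then obtain i a j b where e: "e = {(i, a), (j, b)}" "(i, a) \<noteq> (j, b)" "i \<in> I" "j \<in> I"
      by (elim pairs_of_kind_cases)
    then have "(min i j, max i j, a = b) \<in> C"
      using assms[of i j] assms[of j i] by (cases i j rule: linorder_cases; cases "a = b") auto
    then show ?thesis using that e by (simp add: pairs_of_kind_def kind_pair)
  qed
  then show ?thesis by (auto simp: pairs_of_kind_def)
qed

text \<open>
  Kinds of edges with different and with equal indices.
\<close>

abbreviation loose :: "nat \<Rightarrow> nat \<Rightarrow> nat \<times> nat \<times> bool" where "loose i j \<equiv> (i, j, False)"
abbreviation tight :: "nat \<Rightarrow> nat \<Rightarrow> nat \<times> nat \<times> bool" where "tight i j \<equiv> (i, j, True)"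

text \<open>
  Counted in multiples of \<open>p\<close> and \<open>q\<close>, the complete graphs on the two sides cost 3 and 4, and
  decomposing them independently costs 12. The tiling costs 11. On the left, \<open>A\<close> costs 3, \<open>A \<union> G\<close> and
  \<open>A \<union> G'\<close> cost 2, \<open>G\<close> and \<open>G'\<close> cost 1, and \<open>G \<union> G'\<close> is complete bipartite and free, so that the
  splits over \<open>N\<close>, \<open>H\<close> and \<open>P\<close> all cost 3. On the right \<open>N\<close> costs 2 and \<open>H\<close> costs 1, while
  \<open>N \<union> H'\<close>, \<open>H \<union> H'\<close> and \<open>P \<union> H'\<close> cost 1 each: \<open>H'\<close> supplies the edges that make \<open>N\<close> a star up to a
  free piece, and the same for \<open>P\<close>. The total is
  \<open>2 * 2 + 1 * 1 + 2 * 1 + 1 * 1 + 3 * 1 + 0 * 3 = 11\<close>. The number \<open>?b\<close> is the sum of the six products of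
  exact costs, including the terms of lower order.
\<close>

schematic_goal decomposable_grids:
  fixes p q :: nat
  shows "decomposable 4
     (join (nsets ({0, 1, 2 :: nat} \<times> {..<p}) 2) (nsets ({3, 4, 5, 6 :: nat} \<times> {..<q}) 2)) ?b"
proof -
  let ?X = "pairs_of_kind {0, 1, 2} p" and ?Y = "pairs_of_kind {3, 4, 5, 6} q"
  let ?A = "{loose 0 0, loose 1 1, loose 2 2, loose 0 2, tight 0 2}"
  let ?G = "{loose 0 1, tight 1 2}"
  let ?G' = "{tight 0 1, loose 1 2}"
  let ?N = "{loose 5 5, loose 6 6, loose 3 5, loose 4 5}"
  let ?H = "{tight 3 4}"
  let ?H' = "{loose 4 6, loose 5 6, tight 3 5}"
  let ?P = "{loose 3 3, loose 4 4, loose 3 4, loose 3 6, tight 3 6, tight 4 5, tight 4 6, tight 5 6}"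
  note dec = decomposable_kinds_Un decomposable_star decomposable_bipartite
  have AG: "decomposable 2 (?X (?A \<union> ?G)) (p + p + 1)"
  proof -
    have "?A \<union> ?G = star_kinds {0, 1} {0, 1} {} {} \<union> star_kinds {2} {2} {} {1} \<union> star_kinds {} {0} {2} {2}"
      unfolding star_kinds_def numeral_2_eq_2 by simp blast
    also have "decomposable 2 (?X \<dots>) (p + p + 1)" by (intro dec) (auto simp: star_kinds_def)
    finally show ?thesis .
  qed
  have AG': "decomposable 2 (?X (?A \<union> ?G')) (p + p + 1)"
  proof -
    have "?A \<union> ?G' = star_kinds {1, 2} {1, 2} {} {} \<union> star_kinds {0} {0} {} {1} \<union> star_kinds {} {0} {2} {2}"
      by (auto simp: star_kinds_def)
    also have "decomposable 2 (?X \<dots>) (p + p + 1)" by (intro dec) (auto simp: star_kinds_def)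
    finally show ?thesis .
  qed
  have A: "decomposable 2 (?X ?A) (p + p + p + 1)"
  proof -
    have "?A = star_kinds {0} {0} {} {} \<union> star_kinds {1} {1} {} {} \<union> star_kinds {2} {2} {} {} \<union>
        star_kinds {} {0} {2} {2}"
      by (auto simp: star_kinds_def)
    also have "decomposable 2 (?X \<dots>) (p + p + p + 1)" by (intro dec) (auto simp: star_kinds_def)
    finally show ?thesis .
  qed
  have G: "decomposable 2 (?X ?G) p"
  proof -
    have "?G = star_kinds {} {1} {0} {2}" by (auto simp: star_kinds_def)
    also have "decomposable 2 (?X \<dots>) p" by (intro dec) auto
    finally show ?thesis .
  qed
  have G': "decomposable 2 (?X ?G') p"
  proof -
    have "?G' = star_kinds {} {1} {2} {0}" by (auto simp: star_kinds_def)
    also have "decomposable 2 (?X \<dots>) p" by (intro dec) auto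
    finally show ?thesis .
  qed
  have GG': "decomposable 2 (?X (?G \<union> ?G')) 1"
  proof -
    have "?G \<union> ?G' = star_kinds {} {1} {0, 2} {0, 2}" by (auto simp: star_kinds_def)
    also have "decomposable 2 (?X \<dots>) 1" by (intro dec) auto
    finally show ?thesis .
  qed
  have N: "decomposable 2 (?Y ?N) (q + q)"
  proof -
    have "?N = star_kinds {5} {5} {3, 4} {} \<union> star_kinds {6} {6} {} {}" by (auto simp: star_kinds_def)
    also have "decomposable 2 (?Y \<dots>) (q + q)" by (intro dec) (auto simp: star_kinds_def)
    finally show ?thesis .
  qed
  have NH': "decomposable 2 (?Y (?N \<union> ?H')) (q + 1)"
  proof -
    have "?N \<union> ?H' = star_kinds {5, 6} {5, 6} {4} {} \<union> star_kinds {} {3} {5} {5}"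
      by (auto simp: star_kinds_def)
    also have "decomposable 2 (?Y \<dots>) (q + 1)" by (intro dec) (auto simp: star_kinds_def)
    finally show ?thesis .
  qed
  have H: "decomposable 2 (?Y ?H) q"
  proof -
    have "?H = star_kinds {} {3} {} {4}" by (auto simp: star_kinds_def)
    also have "decomposable 2 (?Y \<dots>) q" by (intro dec) auto
    finally show ?thesis .
  qed
  have HH': "decomposable 2 (?Y (?H \<union> ?H')) q"
  proof -
    have "?H \<union> ?H' = star_kinds {} {4, 5} {6} {3}" by (auto simp: star_kinds_def)
    also have "decomposable 2 (?Y \<dots>) q" by (intro dec) auto
    finally show ?thesis .
  qed
  have PH': "decomposable 2 (?Y (?P \<union> ?H')) (q + 1)"
  proof -
    have "?P \<union> ?H' = star_kinds {3, 4} {3, 4} {} {5} \<union> star_kinds {} {6} {3, 4, 5} {3, 4, 5}"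
      by (auto simp: star_kinds_def)
    also have "decomposable 2 (?Y \<dots>) (q + 1)" by (intro dec) (auto simp: star_kinds_def)
    finally show ?thesis .
  qed
  have P: "decomposable 2 (?Y ?P) (q + 1 + q + q)"
  proof -
    have "?P = star_kinds {3, 4} {3, 4} {} {} \<union> star_kinds {} {3} {6} {6} \<union> star_kinds {} {4} {} {5, 6} \<union>
        star_kinds {} {5} {} {6}"
      by (auto simp: star_kinds_def)
    also have "decomposable 2 (?Y \<dots>) (q + 1 + q + q)" by (intro dec) (auto simp: star_kinds_def)
    finally show ?thesis .
  qed
  have X: "nsets ({0, 1, 2} \<times> {..<p}) 2 = ?X ?A \<union> ?X ?G \<union> ?X ?G'"
  proof -
    have "nsets ({0, 1, 2} \<times> {..<p}) 2 = ?X (?A \<union> ?G \<union> ?G')"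
      by (rule nsets_eq_pairs_of_kind; elim insertE emptyE; simp)
    then show ?thesis by (simp only: pairs_of_kind_Un)
  qed
  have Y: "nsets ({3, 4, 5, 6} \<times> {..<q}) 2 = ?Y ?N \<union> ?Y ?H \<union> ?Y ?H' \<union> ?Y ?P"
  proof -
    have "nsets ({3, 4, 5, 6} \<times> {..<q}) 2 = ?Y (?N \<union> ?H \<union> ?H' \<union> ?P)"
      by (rule nsets_eq_pairs_of_kind; elim insertE emptyE; simp)
    then show ?thesis by (simp only: pairs_of_kind_Un)
  qed
  have "\<Union> (?X C) \<inter> \<Union> (?Y C') = {}" for C C'
    using Union_pairs_of_kind[of "{0, 1, 2}" p C] Union_pairs_of_kind[of "{3, 4, 5, 6}" q C'] by fastforce
  then have "\<Union> (?X ?A \<union> ?X ?G \<union> ?X ?G') \<inter> \<Union> (?Y ?N \<union> ?Y ?H \<union> ?Y ?H' \<union> ?Y ?P) = {}"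
    by (metis pairs_of_kind_Un)
  then have "decomposable (2 + 2)
      (join (?X ?A \<union> ?X ?G \<union> ?X ?G') (?Y ?N \<union> ?Y ?H \<union> ?Y ?H' \<union> ?Y ?P))
      ((p + p + 1) * (q + q) + p * (q + 1) + (p + p + 1) * q + p * q + (p + p + p + 1) * (q + 1) +
        1 * (q + 1 + q + q))"
    using AG G' AG' G A GG' N NH' H HH' PH' P
    by (intro decomposable_tiling) (simp_all only: pairs_of_kind_Un, (rule pairs_of_kind_disjoint, simp)+)
  then show "decomposable 4
      (join (nsets ({0, 1, 2 :: nat} \<times> {..<p}) 2) (nsets ({3, 4, 5, 6 :: nat} \<times> {..<q}) 2))
      ((p + p + 1) * (q + q) + p * (q + 1) + (p + p + 1) * q + p * q + (p + p + p + 1) * (q + 1) +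
        1 * (q + 1 + q + q))"
    unfolding X Y by simp
qed

text \<open>
  A set of size \<open>12 * m\<close> can be arranged both as 3 groups of size \<open>4 * m\<close> and as 4 groups of size
  \<open>3 * m\<close>. With \<open>s = 12 * m\<close> the leading term is \<open>11 / 12 * s\<^sup>2\<close>.
\<close>

lemma decomposable_join_nsets_2:
  assumes "finite U" "finite W" "card U = 12 * m" "card W = 12 * m" "U \<inter> W = {}"
  shows "decomposable 4 (join (nsets U 2) (nsets W 2)) (132 * m\<^sup>2 + 37 * m + 2)"
proof -
  let ?X = "{0, 1, 2 :: nat} \<times> {..<4 * m}" and ?Y = "{3, 4, 5, 6 :: nat} \<times> {..<3 * m}"
  have "card ?X = card U" "card ?Y = card W" using assms by (simp_all add: card_cartesian_product)
  then obtain f g where "bij_betw f ?X U" "bij_betw g ?Y W"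
    using finite_same_card_bij[of ?X U] finite_same_card_bij[of ?Y W] assms(1,2) by auto
  from decomposable_join_nsets_bij[OF decomposable_grids this _ assms(5)] show ?thesis
    by (rule decomposable_mono) (auto simp: power2_eq_square algebra_simps)
qed

theorem theorem1:
  fixes r :: nat
  assumes "even r" and "r \<ge> 6"
  shows "\<exists>\<epsilon> :: nat \<Rightarrow> real. \<epsilon> \<in> o(\<lambda>n. 1) \<and>
    (\<forall>n>0. real (block_number r n) \<le> (14 / 15) powr (real r / 6) * (1 + \<epsilon> n) * real (n choose (r div 2)))"
  using assms decomposable_join_nsets_2 by (rule block_number_bound)

end
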